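(* For every dominant coweight $\lambda$, $$|\{w\in W_a \mid w\leq\theta(\lambda)\}| \;=\; |W_f|\cdot\big|\mathrm{Conv}(W_f\cdot\lambda)\cap(\lambda+\mathbb{Z}\Phi^\vee)\big|.$$
   Context: Let $\Phi$ be an irreducible, reduced, crystallographic root system of rank $n$ spanning a real Euclidean space $V$ with inner product $(-,-)$. Fix simple roots $\alpha_1,\dots,\alpha_n$, with positive roots $\Phi^+$ and highest root $\tilde\alpha$. For $\alpha\in\Phi$ let $\alpha^\vee=2\alpha/(\alpha,\alpha)$; $\mathbb{Z}\Phi^\vee$ is the coroot lattice. The fundamental coweights $\varpi_i^\vee$ are defined by $(\varpi_i^\vee,\alpha_j)=\delta_{ij}$; a dominant coweight is a combination $\sum_i m_i\varpi_i^\vee$ with all $m_i\in\mathbb{Z}_{\geq 0}$. $W_f$ is the finite Weyl group generated by the reflections $s_i$ in the hyperplanes orthogonal to $\alpha_i$, acting linearly on $V$, and $w_0$ is its longest element. The affine Weyl group $W_a$ is the group of affine transformations of $V$ generated by $W_f$ and the translations by elements of $\mathbb{Z}\Phi^\vee$; it is a Coxeter group with generators $s_1,\dots,s_n,s_0$, where $s_0$ is the reflection in the affine hyperplane $\{v:(v,\tilde\alpha)=-1\}$, and $\leq$ denotes its Bruhat order. Alcoves are the connected components of $V$ minus all hyperplanes $\{v:(v,\alpha)=k\}$, $\alpha\in\Phi$, $k\in\mathbb{Z}$. The fundamental alcove is $A_{\mathrm{id}}=\{v\in V: -1<(v,\alpha)<0 \ \forall \alpha\in\Phi^+\}$, and $w\mapsto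 A_w:=wA_{\mathrm{id}}$ is a bijection from $W_a$ to the set of alcoves. For a dominant coweight $\lambda$, $\theta(\lambda)\in W_a$ is the unique element with $A_{\theta(\lambda)}=A_{w_0}+\lambda$. $\mathrm{Conv}$ denotes convex hull. *)

theory Defs
  imports
    "HOL-Analysis.Analysis"
    "HOL-Algebra.Bij"
    "HOL-Algebra.Generated_Groups"
begin

section \<open>Root systems\<close>

definition coroot :: "'a::real_inner \<Rightarrow> 'a" where
  "coroot \<alpha> = (2 / (\<alpha> \<bullet> \<alpha>)) *\<^sub>R \<alpha>"

text \<open>The orthogonal reflection in the affine hyperplane of all \<open>v\<close> with \<open>v \<bullet> \<alpha> = k\<close>.\<close>

definition hyperplane_reflection :: "'a::real_inner \<Rightarrow> real \<Rightarrow> 'a \<Rightarrow> 'a" where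
  "hyperplane_reflection \<alpha> k v = v - (v \<bullet> \<alpha> - k) *\<^sub>R coroot \<alpha>"

definition nonneg_combinations :: "'a::real_vector set \<Rightarrow> 'a set" where
  "nonneg_combinations B = range (\<lambda>m :: 'a \<Rightarrow> nat. \<Sum>\<alpha>\<in>B. real (m \<alpha>) *\<^sub>R \<alpha>)"

text \<open>The ambient type is the space spanned by the roots, so the rank is its dimension.\<close>

locale irreducible_root_system =
  fixes \<Phi> :: "'a::euclidean_space set"
  assumes finite_roots: "finite \<Phi>"
    and spanning: "span \<Phi> = UNIV"
    and zero_not_root: "0 \<notin> \<Phi>"
    and reflection_closed: "\<And>\<alpha>. \<alpha> \<in> \<Phi> \<Longrightarrow> hyperplane_reflection \<alpha> 0 ` \<Phi> = \<Phi>"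
    and crystallographic: "\<And>\<alpha> \<beta>. \<lbrakk>\<alpha> \<in> \<Phi>; \<beta> \<in> \<Phi>\<rbrakk> \<Longrightarrow> \<beta> \<bullet> coroot \<alpha> \<in> \<int>"
    and reduced: "\<And>\<alpha> c. \<lbrakk>\<alpha> \<in> \<Phi>; c *\<^sub>R \<alpha> \<in> \<Phi>\<rbrakk> \<Longrightarrow> c = 1 \<or> c = - 1"
    and nonempty: "\<Phi> \<noteq> {}"
    and irreducible: "\<And>\<Phi>1 \<Phi>2. \<lbrakk>\<Phi> = \<Phi>1 \<union> \<Phi>2; \<And>\<alpha> \<beta>. \<lbrakk>\<alpha> \<in> \<Phi>1; \<beta> \<in> \<Phi>2\<rbrakk> \<Longrightarrow> \<alpha> \<bullet> \<beta> = 0\<rbrakk>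
                        \<Longrightarrow> \<Phi>1 = {} \<or> \<Phi>2 = {}"

locale irreducible_root_system_with_base = irreducible_root_system \<Phi>
  for \<Phi> :: "'a::euclidean_space set" +
  fixes \<Delta> :: "'a set"
  assumes simple_roots: "\<Delta> \<subseteq> \<Phi>"
    and simple_independent: "independent \<Delta>"
    and simple_spanning: "span \<Delta> = UNIV"
    and positive_or_negative:
      "\<And>\<beta>. \<beta> \<in> \<Phi> \<Longrightarrow> \<beta> \<in> nonneg_combinations \<Delta> \<or> - \<beta> \<in> nonneg_combinations \<Delta>"

definition positive_roots :: "'a::euclidean_space set \<Rightarrow> 'a set \<Rightarrow> 'a set" where
  "positive_roots \<Phi> \<Delta> = \<Phi> \<inter> nonneg_combinations \<Delta>"

definition highest_root :: "'a::euclidean_space set \<Rightarrow> 'a set \<Rightarrow> 'a" where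
  "highest_root \<Phi> \<Delta> = (THE \<alpha>. \<alpha> \<in> \<Phi> \<and> (\<forall>\<beta>\<in>\<Phi>. \<alpha> - \<beta> \<in> nonneg_combinations \<Delta>))"

definition coroot_lattice :: "'a::euclidean_space set \<Rightarrow> 'a set" where
  "coroot_lattice \<Phi> = range (\<lambda>c :: 'a \<Rightarrow> int. \<Sum>\<alpha>\<in>\<Phi>. of_int (c \<alpha>) *\<^sub>R coroot \<alpha>)"

definition fundamental_coweight :: "'a::euclidean_space set \<Rightarrow> 'a \<Rightarrow> 'a" where
  "fundamental_coweight \<Delta> \<alpha> = (THE v. \<forall>\<beta>\<in>\<Delta>. v \<bullet> \<beta> = (if \<alpha> = \<beta> then 1 else 0))"

definition dominant_coweights :: "'a::euclidean_space set \<Rightarrow> 'a set" where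
  "dominant_coweights \<Delta> =
     range (\<lambda>m :: 'a \<Rightarrow> nat. \<Sum>\<alpha>\<in>\<Delta>. real (m \<alpha>) *\<^sub>R fundamental_coweight \<Delta> \<alpha>)"


section \<open>Length and Bruhat order\<close>

text \<open>
  Groups of transformations are sets of functions under composition. For a Coxeter system
  \<open>(W, S)\<close> of this kind, \<open>bruhat_le W S\<close> is the reflexive-transitive closure of \<open>u \<rightarrow> u t\<close>,
  where \<open>t\<close> is a conjugate of an element of \<open>S\<close> and right multiplication by \<open>t\<close> increases
  the length. The inverse of a function is spelled \<open>inv_into UNIV\<close> because the group syntax
  of \<open>HOL-Algebra\<close> takes over the shorter notation.
\<close>

definition word_length :: "('a \<Rightarrow> 'a) set \<Rightarrow> ('a \<Rightarrow> 'a) \<Rightarrow> nat" where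
  "word_length S w = (LEAST k. \<exists>ss. set ss \<subseteq> S \<and> length ss = k \<and> foldr (\<circ>) ss id = w)"

definition coxeter_reflections :: "('a \<Rightarrow> 'a) set \<Rightarrow> ('a \<Rightarrow> 'a) set \<Rightarrow> ('a \<Rightarrow> 'a) set" where
  "coxeter_reflections W S = {w \<circ> s \<circ> inv_into UNIV w | w s. w \<in> W \<and> s \<in> S}"

definition bruhat_le ::
    "('a \<Rightarrow> 'a) set \<Rightarrow> ('a \<Rightarrow> 'a) set \<Rightarrow> ('a \<Rightarrow> 'a) \<Rightarrow> ('a \<Rightarrow> 'a) \<Rightarrow> bool" where
  "bruhat_le W S =
     (\<lambda>u v. u \<in> W \<and> (\<exists>t\<in>coxeter_reflections W S. v = u \<circ> t \<and> word_length S u < word_length S v))\<^sup>*\<^sup>*"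


section \<open>The finite and the affine Weyl group\<close>

definition simple_reflections :: "'a::euclidean_space set \<Rightarrow> ('a \<Rightarrow> 'a) set" where
  "simple_reflections \<Delta> = (\<lambda>\<alpha>. hyperplane_reflection \<alpha> 0) ` \<Delta>"

definition finite_weyl_group :: "'a::euclidean_space set \<Rightarrow> ('a \<Rightarrow> 'a) set" where
  "finite_weyl_group \<Delta> = generate (BijGroup UNIV) (simple_reflections \<Delta>)"

definition longest_element :: "'a::euclidean_space set \<Rightarrow> 'a \<Rightarrow> 'a" where
  "longest_element \<Delta> =
     (THE w. is_arg_max (word_length (simple_reflections \<Delta>)) (\<lambda>w. w \<in> finite_weyl_group \<Delta>) w)"

definition affine_weyl_group :: "'a::euclidean_space set \<Rightarrow> 'a set \<Rightarrow> ('a \<Rightarrow> 'a) set" where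
  "affine_weyl_group \<Phi> \<Delta> =
     generate (BijGroup UNIV) (finite_weyl_group \<Delta> \<union> (+) ` coroot_lattice \<Phi>)"

definition affine_simple_reflections ::
    "'a::euclidean_space set \<Rightarrow> 'a set \<Rightarrow> ('a \<Rightarrow> 'a) set" where
  "affine_simple_reflections \<Phi> \<Delta> =
     insert (hyperplane_reflection (highest_root \<Phi> \<Delta>) (- 1)) (simple_reflections \<Delta>)"

definition affine_bruhat_le ::
    "'a::euclidean_space set \<Rightarrow> 'a set \<Rightarrow> ('a \<Rightarrow> 'a) \<Rightarrow> ('a \<Rightarrow> 'a) \<Rightarrow> bool" where
  "affine_bruhat_le \<Phi> \<Delta> = bruhat_le (affine_weyl_group \<Phi> \<Delta>) (affine_simple_reflections \<Phi> \<Delta>)"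

definition fundamental_alcove :: "'a::euclidean_space set \<Rightarrow> 'a set \<Rightarrow> 'a set" where
  "fundamental_alcove \<Phi> \<Delta> = {v. \<forall>\<alpha>\<in>positive_roots \<Phi> \<Delta>. - 1 < v \<bullet> \<alpha> \<and> v \<bullet> \<alpha> < 0}"

definition alcove :: "'a::euclidean_space set \<Rightarrow> 'a set \<Rightarrow> ('a \<Rightarrow> 'a) \<Rightarrow> 'a set" where
  "alcove \<Phi> \<Delta> w = w ` fundamental_alcove \<Phi> \<Delta>"

definition theta_element :: "'a::euclidean_space set \<Rightarrow> 'a set \<Rightarrow> 'a \<Rightarrow> ('a \<Rightarrow> 'a)" where
  "theta_element \<Phi> \<Delta> l =
     (THE w. w \<in> affine_weyl_group \<Phi> \<Delta> \<and>
             alcove \<Phi> \<Delta> w = (+) l ` alcove \<Phi> \<Delta> (longest_element \<Delta>))"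

end

theory Submission
  imports Defs
begin

text \<open>
  Let \<open>\<nu>\<close> be the vertex of the fundamental alcove with \<open>\<theta>(\<lambda>) \<nu> = \<lambda>\<close>. It is a special point, its orbit is
  \<open>\<lambda> + \<int>\<Phi>\<^sup>\<or>\<close>, and exactly \<open>|W\<^sub>f|\<close> elements of \<open>W\<^sub>a\<close> carry it to a given point of the orbit. So it suffices
  that \<open>w \<le> \<theta>(\<lambda>)\<close> holds if and only if \<open>w \<nu>\<close> lies in \<open>Conv (W\<^sub>f \<lambda>)\<close>.

  By the exchange property, left multiplication by the reflection in a hyperplane \<open>H\<close> raises the
  length of \<open>w\<close> if and only if \<open>H\<close> does not separate \<open>A\<^sub>w\<close> from the fundamental alcove. Going down in
  the Bruhat order therefore reflects \<open>w \<nu>\<close> towards the origin, to a point of the segment from \<open>w \<nu>\<close>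
  to its image under a linear reflection in \<open>W\<^sub>f\<close>, so one never leaves the convex hull.

  Conversely, starting from a point of the hull one goes up: first by simple reflections to a
  dominant point \<open>\<mu>\<close>, then from \<open>\<mu>\<close> to \<open>\<lambda>\<close> by adding one simple coroot at a time. The latter works
  because a point \<open>x \<noteq> \<mu>\<close> in \<open>\<mu> + \<Sum> \<nat> \<alpha>\<^sub>i\<^sup>\<or>\<close> has positive product with some \<open>\<alpha>\<^sub>i\<close> for which
  \<open>x - \<alpha>\<^sub>i\<^sup>\<or>\<close> is still in this set. Among the elements carrying \<open>\<nu>\<close> to \<open>\<lambda>\<close>, the largest is \<open>\<theta>(\<lambda>)\<close>.
\<close>

section \<open>Integers and finite maxima\<close>

lemma Ints_strictly_between: "\<lbrakk>k \<in> \<int>; a < k; k < a + 1; a \<in> \<int>\<rbrakk> \<Longrightarrow> False" for k a :: real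
proof -
  assume a: "k \<in> \<int>" "a < k" "k < a + 1" "a \<in> \<int>"
  then obtain i j where "k = of_int i" "a = of_int j" by (auto elim!: Ints_cases)
  with a(2,3) have "j < i" "real_of_int i < real_of_int (j + 1)" by auto
  then show False unfolding of_int_less_iff by simp
qed

lemma Ints_between_minus1_1: "\<lbrakk>k \<in> \<int>; - 1 < k; k < 1\<rbrakk> \<Longrightarrow> k = 0" for k :: real
  using Ints_nonzero_abs_less1[of k] by force

lemma Ints_less_imp_le_diff: "\<lbrakk>a \<in> \<int>; b \<in> \<int>; a < b\<rbrakk> \<Longrightarrow> a \<le> b - 1" for a b :: real
  using Ints_strictly_between[of b a] by force

lemma finite_is_arg_max:
  fixes f :: "'b \<Rightarrow> 'c::linorder"
  assumes "finite B" "B \<noteq> {}"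
  shows "\<exists>x. is_arg_max f (\<lambda>x. x \<in> B) x"
proof -
  have "Max (f ` B) \<in> f ` B" using assms by simp
  then obtain x where "x \<in> B" "f x = Max (f ` B)" by auto
  then show ?thesis
    using assms(1) Max_ge[of "f ` B"] by (auto simp: is_arg_max_def not_less[symmetric] intro!: exI[of _ x])
qed


section \<open>Words of involutions\<close>

definition word_prod :: "('a \<Rightarrow> 'a) list \<Rightarrow> 'a \<Rightarrow> 'a" where
  "word_prod ss = foldr (\<circ>) ss id"

definition words :: "('a \<Rightarrow> 'a) set \<Rightarrow> ('a \<Rightarrow> 'a) set" where
  "words S = {word_prod ss | ss. set ss \<subseteq> S}"

lemma word_prod_Nil: "word_prod [] = id"
  by (simp add: word_prod_def)

lemma word_prod_Cons: "word_prod (s # ss) = s \<circ> word_prod ss"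
  by (simp add: word_prod_def)

lemma word_prod_append: "word_prod (xs @ ys) = word_prod xs \<circ> word_prod ys"
  by (induction xs) (auto simp: word_prod_Nil word_prod_Cons)

lemma id_in_words: "id \<in> words S"
  unfolding words_def by (auto simp: word_prod_Nil intro!: exI[of _ "[]"])

lemma generator_in_words: "s \<in> S \<Longrightarrow> s \<in> words S"
  unfolding words_def
  by (auto simp: word_prod_Nil word_prod_Cons intro!: exI[of _ "[s]"])

lemma words_comp: "\<lbrakk>f \<in> words S; g \<in> words S\<rbrakk> \<Longrightarrow> f \<circ> g \<in> words S"
  unfolding words_def
  by (smt (verit) Un_least mem_Collect_eq set_append word_prod_append)

lemma words_mono: "S \<subseteq> T \<Longrightarrow> words S \<subseteq> words T"
  unfolding words_def by auto

lemma words_induct [consumes 1, case_names id step]: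
  assumes "f \<in> words S" "P id"
    and "\<And>s f. \<lbrakk>s \<in> S; f \<in> words S; P f\<rbrakk> \<Longrightarrow> P (s \<circ> f)"
  shows "P f"
proof -
  obtain ss where ss: "set ss \<subseteq> S" "f = word_prod ss"
    using assms(1) unfolding words_def by blast
  have "P (word_prod ss)" using ss(1)
  proof (induction ss)
    case Nil
    show ?case unfolding word_prod_Nil by (rule assms(2))
  next
    case (Cons s ss)
    then have "s \<in> S" "set ss \<subseteq> S" by simp_all
    moreover from this(2) have "word_prod ss \<in> words S" "P (word_prod ss)"
      using Cons.IH unfolding words_def by blast+
    ultimately have "P (s \<circ> word_prod ss)" using assms(3) by blast
    then show ?case unfolding word_prod_Cons .
  qed
  then show ?thesis using ss by metis
qed

lemma involution_bij: "s \<circ> s = id \<Longrightarrow> bij s"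
  by (metis o_bij)

lemma words_inverse:
  assumes inv: "\<And>s. s \<in> S \<Longrightarrow> s \<circ> s = id" and "f \<in> words S"
  shows "\<exists>g\<in>words S. f \<circ> g = id \<and> g \<circ> f = id"
  using assms(2)
proof (induction rule: words_induct)
  case id
  then show ?case using id_in_words by (intro bexI[of _ id]) auto
next
  case (step s f)
  then obtain g where g: "g \<in> words S" "f \<circ> g = id" "g \<circ> f = id" by blast
  have "(s \<circ> f) \<circ> (g \<circ> s) = id"
    using g(2) inv[OF step(1)] by (metis comp_assoc id_comp)
  moreover have "(g \<circ> s) \<circ> (s \<circ> f) = id"
    using g(3) inv[OF step(1)] by (metis comp_assoc id_comp)
  ultimately show ?case
    using words_comp[OF g(1) generator_in_words[OF step(1)]] by blast
qed

lemma BijGroup_mult: "\<lbrakk>bij f; bij g\<rbrakk> \<Longrightarrow> f \<otimes>\<^bsub>BijGroup UNIV\<^esub> g = f \<circ> g"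
  by (simp add: BijGroup_def Bij_def compose_def fun_eq_iff)

lemma BijGroup_one: "\<one>\<^bsub>BijGroup UNIV\<^esub> = id"
  by (simp add: BijGroup_def fun_eq_iff)

lemma BijGroup_inv: "bij f \<Longrightarrow> inv\<^bsub>BijGroup UNIV\<^esub> f = inv_into UNIV f"
  by (subst inv_BijGroup) (auto simp: Bij_def)

lemma generate_bij:
  assumes "\<And>s. s \<in> S \<Longrightarrow> bij s" "f \<in> generate (BijGroup UNIV) S"
  shows "bij f"
  using assms(2)
proof (induction rule: generate.induct)
  case one
  then show ?case unfolding BijGroup_one by (rule bij_id)
next
  case (incl h)
  then show ?case using assms(1) by blast
next
  case (inv h)
  then show ?case using assms(1) by (simp add: BijGroup_inv bij_imp_bij_inv)
next
  case (eng f g)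
  show ?case unfolding BijGroup_mult[OF eng(3,4)] using eng(4,3) by (rule bij_comp)
qed

text \<open>Involutive generators are their own inverses, so the group they generate consists of
  plain words, the objects over which \<open>word_length\<close> minimises.\<close>

lemma generate_involutions:
  assumes inv: "\<And>s. s \<in> S \<Longrightarrow> s \<circ> s = id"
  shows "generate (BijGroup UNIV) S = words S"
proof
  have bij: "\<And>s. s \<in> S \<Longrightarrow> bij s" using inv involution_bij by blast
  show "generate (BijGroup UNIV) S \<subseteq> words S"
  proof
    fix f assume "f \<in> generate (BijGroup UNIV) S"
    then show "f \<in> words S"
    proof (induction rule: generate.induct)
      case one
      then show ?case unfolding BijGroup_one by (rule id_in_words)
    next
      case (incl h)
      then show ?case by (rule generator_in_words)
    next
      case (inv h)
      then have "inv_into UNIV h = h"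
        using assms by (metis bij bij_is_inj comp_assoc comp_id id_comp inv_o_cancel)
      then show ?case using inv bij by (simp add: BijGroup_inv generator_in_words)
    next
      case (eng f g)
      have "bij f" "bij g" using eng(1,2) generate_bij[OF bij] by metis+
      from BijGroup_mult[OF this] show ?case
        using words_comp[OF eng(3,4)] by metis
    qed
  qed
  show "words S \<subseteq> generate (BijGroup UNIV) S"
  proof
    fix f assume "f \<in> words S"
    then show "f \<in> generate (BijGroup UNIV) S"
    proof (induction rule: words_induct)
      case id
      then show ?case using generate.one[of "BijGroup UNIV" S] unfolding BijGroup_one .
    next
      case (step s f)
      have "bij f" using step(3) generate_bij[OF bij] by metis
      from BijGroup_mult[OF bij[OF step(1)] this] show ?case
        using generate.eng[OF generate.incl[OF step(1)] step(3)] by metis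
    qed
  qed
qed

lemma word_length_le: "set ss \<subseteq> S \<Longrightarrow> word_length S (word_prod ss) \<le> length ss"
  unfolding word_length_def word_prod_def by (rule Least_le) blast

lemma word_length_attained:
  assumes "w \<in> words S"
  obtains ss where "set ss \<subseteq> S" "length ss = word_length S w" "word_prod ss = w"
proof -
  have "\<exists>k ss. set ss \<subseteq> S \<and> length ss = k \<and> word_prod ss = w"
    using assms unfolding words_def by blast
  then have "\<exists>k ss. set ss \<subseteq> S \<and> length ss = k \<and> foldr (\<circ>) ss id = w"
    unfolding word_prod_def .
  from LeastI_ex[OF this] show ?thesis using that unfolding word_length_def word_prod_def by blast
qed


section \<open>Reflections\<close>

lemma coroot_minus: "coroot (- \<alpha>) = - coroot \<alpha>"
  by (simp add: coroot_def)

lemma inner_coroot_self: "\<alpha> \<noteq> 0 \<Longrightarrow> \<alpha> \<bullet> coroot \<alpha> = 2"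
  by (simp add: coroot_def)

lemma hyperplane_reflection_minus:
  "hyperplane_reflection (- \<alpha>) (- k) = hyperplane_reflection \<alpha> k"
  by (simp add: hyperplane_reflection_def coroot_minus fun_eq_iff algebra_simps)

lemma hyperplane_reflection_inner_self:
  "\<alpha> \<noteq> 0 \<Longrightarrow> hyperplane_reflection \<alpha> k v \<bullet> \<alpha> = 2 * k - v \<bullet> \<alpha>"
  using inner_coroot_self[of \<alpha>]
  by (simp add: hyperplane_reflection_def inner_diff_left inner_commute[of _ \<alpha>] inner_diff_right algebra_simps)

lemma hyperplane_reflection_involution:
  "\<alpha> \<noteq> 0 \<Longrightarrow> hyperplane_reflection \<alpha> k (hyperplane_reflection \<alpha> k v) = v"
  by (subst hyperplane_reflection_def, subst hyperplane_reflection_inner_self)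
    (auto simp: hyperplane_reflection_def algebra_simps)

lemma hyperplane_reflection_affine:
  "hyperplane_reflection \<alpha> k v = k *\<^sub>R coroot \<alpha> + hyperplane_reflection \<alpha> 0 v"
  by (simp add: hyperplane_reflection_def algebra_simps)

lemma linear_reflection: "linear (hyperplane_reflection \<alpha> 0)"
  by (rule linearI) (simp_all add: hyperplane_reflection_def algebra_simps)

lemma reflection_inner_commute:
  "hyperplane_reflection \<alpha> 0 x \<bullet> y = x \<bullet> hyperplane_reflection \<alpha> 0 y"
  by (simp add: hyperplane_reflection_def coroot_def inner_diff_left inner_diff_right inner_commute)

text \<open>The linear part of the reflection is self-adjoint and moves across the inner product,
  while the translation part shifts the level. The right-hand side is the pullback of the hyperplane
  \<open>(\<beta>, c)\<close>.\<close>

lemma hyperplane_reflection_inner: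
  "hyperplane_reflection \<alpha> k v \<bullet> \<beta> - c
     = v \<bullet> hyperplane_reflection \<alpha> 0 \<beta> - (c - k * (coroot \<alpha> \<bullet> \<beta>))"
  by (subst hyperplane_reflection_affine) (simp add: inner_add_left reflection_inner_commute)


lemma bij_translation: "bij ((+) (x::'a::ab_group_add))"
  by (rule o_bij[of "(+) (- x)"]) (auto simp: fun_eq_iff)

lemma inv_translation: "inv_into UNIV ((+) (x::'a::ab_group_add)) = (+) (- x)"
  by (rule inv_unique_comp) (auto simp: fun_eq_iff)


section \<open>The finite Weyl group\<close>

abbreviation hrefl :: "'a::real_inner \<Rightarrow> real \<Rightarrow> 'a \<Rightarrow> 'a" ("\<sigma>") where
  "\<sigma> \<equiv> hyperplane_reflection"

context irreducible_root_system_with_base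
begin

abbreviation W where "W \<equiv> finite_weyl_group \<Delta>"
abbreviation Wa where "Wa \<equiv> affine_weyl_group \<Phi> \<Delta>"
abbreviation Q where "Q \<equiv> coroot_lattice \<Phi>"
abbreviation Pos where "Pos \<equiv> positive_roots \<Phi> \<Delta>"
abbreviation \<omega> where "\<omega> \<equiv> fundamental_coweight \<Delta>"

lemma finite_simple: "finite \<Delta>"
  using simple_roots finite_roots finite_subset by blast

lemma simple_root: "\<alpha> \<in> \<Delta> \<Longrightarrow> \<alpha> \<in> \<Phi>"
  using simple_roots by blast

lemma root_nonzero: "\<alpha> \<in> \<Phi> \<Longrightarrow> \<alpha> \<noteq> 0"
  using zero_not_root by blast

lemma reflection_root: "\<lbrakk>\<alpha> \<in> \<Phi>; \<beta> \<in> \<Phi>\<rbrakk> \<Longrightarrow> \<sigma> \<alpha> 0 \<beta> \<in> \<Phi>"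
  using reflection_closed by blast

lemma reflection_self: "\<alpha> \<in> \<Phi> \<Longrightarrow> \<sigma> \<alpha> 0 \<alpha> = - \<alpha>"
  by (simp add: hyperplane_reflection_def coroot_def root_nonzero scaleR_2)

lemma minus_root: "\<alpha> \<in> \<Phi> \<Longrightarrow> - \<alpha> \<in> \<Phi>"
  using reflection_root[of \<alpha> \<alpha>] reflection_self by simp

lemma reflection_comp_self: "\<alpha> \<in> \<Phi> \<Longrightarrow> \<sigma> \<alpha> k \<circ> \<sigma> \<alpha> k = id"
  using hyperplane_reflection_involution[OF root_nonzero] by (auto simp: fun_eq_iff)

section \<open>Coordinates with respect to the simple roots\<close>

lemma inner_eqI:
  assumes "\<And>\<beta>. \<beta> \<in> \<Delta> \<Longrightarrow> x \<bullet> \<beta> = y \<bullet> \<beta>"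
  shows "x = y"
proof -
  have "(x - y) \<bullet> z = 0" for z
  proof -
    have "z \<in> span \<Delta>" using simple_spanning by simp
    then show ?thesis
      by (induction rule: span_induct_alt)
        (use assms in \<open>auto simp: inner_add_right inner_diff_left\<close>)
  qed
  from this[of "x - y"] show ?thesis by simp
qed

text \<open>Independence extends the prescribed values to a linear functional, and the adjoint of
  that functional at 1 is the vector representing it.\<close>

lemma prescribed_inner: "\<exists>x. \<forall>\<beta>\<in>\<Delta>. x \<bullet> \<beta> = c \<beta>"
proof -
  obtain g :: "'a \<Rightarrow> real" where g: "linear g" "\<forall>\<beta>\<in>\<Delta>. g \<beta> = c \<beta>"
    using linear_independent_extend[OF simple_independent] by blast
  have "adjoint g 1 \<bullet> \<beta> = g \<beta>" for \<beta>
    using adjoint_works[OF g(1), of \<beta> 1] by (simp add: inner_commute)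
  then show ?thesis using g(2) by (intro exI[of _ "adjoint g 1"]) simp
qed

lemma fundamental_coweight_inner:
  assumes "\<beta> \<in> \<Delta>"
  shows "\<omega> \<alpha> \<bullet> \<beta> = (if \<alpha> = \<beta> then 1 else 0)"
proof -
  have "\<exists>!v. \<forall>\<beta>\<in>\<Delta>. v \<bullet> \<beta> = (if \<alpha> = \<beta> then 1 else 0)"
    using prescribed_inner[of "\<lambda>\<beta>. if \<alpha> = \<beta> then 1 else 0"] inner_eqI by (metis (no_types, lifting))
  from theI'[OF this] show ?thesis using assms unfolding fundamental_coweight_def by blast
qed

lemma sum_simple_coweight:
  assumes "\<beta> \<in> \<Delta>"
  shows "(\<Sum>\<alpha>\<in>\<Delta>. c \<alpha> *\<^sub>R \<alpha>) \<bullet> \<omega> \<beta> = c \<beta>"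
proof -
  have "(\<Sum>\<alpha>\<in>\<Delta>. c \<alpha> *\<^sub>R \<alpha>) \<bullet> \<omega> \<beta> = (\<Sum>\<alpha>\<in>\<Delta>. if \<beta> = \<alpha> then c \<alpha> else 0)"
    unfolding inner_sum_left
    by (intro sum.cong) (auto simp: fundamental_coweight_inner inner_commute[of _ "\<omega> \<beta>"])
  then show ?thesis using assms finite_simple by simp
qed

lemma simple_expansion: "(\<Sum>\<alpha>\<in>\<Delta>. (x \<bullet> \<omega> \<alpha>) *\<^sub>R \<alpha>) = x"
proof -
  have "x \<in> range (\<lambda>u. \<Sum>\<alpha>\<in>\<Delta>. u \<alpha> *\<^sub>R \<alpha>)"
    using simple_spanning span_finite[OF finite_simple] by auto
  then obtain u where u: "x = (\<Sum>\<alpha>\<in>\<Delta>. u \<alpha> *\<^sub>R \<alpha>)" by blast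
  then have "x \<bullet> \<omega> \<alpha> = u \<alpha>" if "\<alpha> \<in> \<Delta>" for \<alpha>
    using sum_simple_coweight[OF that] by simp
  then show ?thesis using u by simp
qed

text \<open>Lets the signs of coefficients and of products with simple roots decide the sign of an
  inner product.\<close>

lemma inner_simple_expansion: "x \<bullet> y = (\<Sum>\<alpha>\<in>\<Delta>. (x \<bullet> \<omega> \<alpha>) * (\<alpha> \<bullet> y))"
  by (subst simple_expansion[of x, symmetric]) (simp only: inner_sum_left inner_scaleR_left)

lemma nonneg_combinations_iff:
  "x \<in> nonneg_combinations \<Delta> \<longleftrightarrow> (\<forall>\<alpha>\<in>\<Delta>. x \<bullet> \<omega> \<alpha> \<in> \<nat>)"
proof
  assume "x \<in> nonneg_combinations \<Delta>"
  then obtain m :: "'a \<Rightarrow> nat" where "x = (\<Sum>\<alpha>\<in>\<Delta>. real (m \<alpha>) *\<^sub>R \<alpha>)"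
    unfolding nonneg_combinations_def by blast
  then show "\<forall>\<alpha>\<in>\<Delta>. x \<bullet> \<omega> \<alpha> \<in> \<nat>" using sum_simple_coweight by simp
next
  assume "\<forall>\<alpha>\<in>\<Delta>. x \<bullet> \<omega> \<alpha> \<in> \<nat>"
  then have "\<forall>\<alpha>\<in>\<Delta>. \<exists>n. x \<bullet> \<omega> \<alpha> = real n" by (auto elim: Nats_cases)
  from bchoice[OF this] obtain m where m: "\<forall>\<alpha>\<in>\<Delta>. x \<bullet> \<omega> \<alpha> = real (m \<alpha>)" by blast
  have "x = (\<Sum>\<alpha>\<in>\<Delta>. real (m \<alpha>) *\<^sub>R \<alpha>)"
    using m simple_expansion[of x] by (metis (mono_tags, lifting) sum.cong)
  then show "x \<in> nonneg_combinations \<Delta>" unfolding nonneg_combinations_def by blast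
qed

section \<open>Positive roots\<close>

lemma positive_iff: "\<beta> \<in> Pos \<longleftrightarrow> \<beta> \<in> \<Phi> \<and> (\<forall>\<alpha>\<in>\<Delta>. \<beta> \<bullet> \<omega> \<alpha> \<in> \<nat>)"
  by (simp add: positive_roots_def nonneg_combinations_iff)

lemma positive_root: "\<beta> \<in> Pos \<Longrightarrow> \<beta> \<in> \<Phi>"
  by (simp add: positive_iff)

lemma positive_coeff_ge_0: "\<lbrakk>\<beta> \<in> Pos; \<alpha> \<in> \<Delta>\<rbrakk> \<Longrightarrow> 0 \<le> \<beta> \<bullet> \<omega> \<alpha>"
  using positive_iff Nats_altdef2 by blast

lemma root_cases: "\<beta> \<in> \<Phi> \<Longrightarrow> \<beta> \<in> Pos \<or> - \<beta> \<in> Pos"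
  using positive_or_negative minus_root unfolding positive_roots_def by blast

lemma root_coeff_Ints:
  assumes "\<beta> \<in> \<Phi>" "\<alpha> \<in> \<Delta>"
  shows "\<beta> \<bullet> \<omega> \<alpha> \<in> \<int>"
proof -
  have "\<beta> \<bullet> \<omega> \<alpha> \<in> \<nat> \<or> - (\<beta> \<bullet> \<omega> \<alpha>) \<in> \<nat>"
    using root_cases[OF assms(1)] assms(2) by (auto simp: positive_iff)
  then show ?thesis using Nats_subset_Ints minus_in_Ints_iff by blast
qed

text \<open>The nonzero coefficients of a root all have the same sign, so a single positive one
  decides.\<close>

lemma positive_coeff_imp_positive:
  assumes "\<beta> \<in> \<Phi>" "\<alpha> \<in> \<Delta>" "\<beta> \<bullet> \<omega> \<alpha> > 0"
  shows "\<beta> \<in> Pos"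
  using root_cases[OF assms(1)] positive_coeff_ge_0[of "- \<beta>" \<alpha>] assms by force

lemma simple_positive: "\<alpha> \<in> \<Delta> \<Longrightarrow> \<alpha> \<in> Pos"
  by (rule positive_coeff_imp_positive[of \<alpha> \<alpha>])
    (auto simp: simple_root inner_commute[of _ "\<omega> _"] fundamental_coweight_inner)

lemma not_positive_and_negative:
  assumes "\<beta> \<in> Pos" shows "- \<beta> \<notin> Pos"
proof
  assume "- \<beta> \<in> Pos"
  then have "\<beta> \<bullet> \<omega> \<alpha> = 0" if "\<alpha> \<in> \<Delta>" for \<alpha>
    using positive_coeff_ge_0[OF \<open>- \<beta> \<in> Pos\<close> that] positive_coeff_ge_0[OF assms that] by simp
  then have "\<beta> = 0" using simple_expansion[of \<beta>] by simp
  then show False using assms positive_root root_nonzero by blast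
qed

lemma simple_reflection_coeff:
  assumes "\<alpha> \<in> \<Delta>" "\<gamma> \<in> \<Delta>"
  shows "\<sigma> \<alpha> 0 x \<bullet> \<omega> \<gamma> = x \<bullet> \<omega> \<gamma> - (if \<gamma> = \<alpha> then x \<bullet> coroot \<alpha> else 0)"
  using assms fundamental_coweight_inner[OF assms(1), of \<gamma>]
  by (auto simp: hyperplane_reflection_def coroot_def inner_diff_right inner_commute[of _ "\<omega> _"])

text \<open>A simple reflection alters only the \<alpha>-coefficient. Since the root system is
  reduced, a positive root other than \<alpha> also has a positive coefficient at another simple
  root, and that one survives.\<close>

lemma simple_reflection_positive:
  assumes "\<alpha> \<in> \<Delta>" "\<beta> \<in> Pos" "\<beta> \<noteq> \<alpha>"
  shows "\<sigma> \<alpha> 0 \<beta> \<in> Pos"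
proof -
  have "\<exists>\<gamma>\<in>\<Delta>. \<gamma> \<noteq> \<alpha> \<and> \<beta> \<bullet> \<omega> \<gamma> > 0"
  proof (rule ccontr)
    assume "\<not> ?thesis"
    then have "\<beta> \<bullet> \<omega> \<gamma> = 0" if "\<gamma> \<in> \<Delta>" "\<gamma> \<noteq> \<alpha>" for \<gamma>
      using that positive_coeff_ge_0[OF assms(2) that(1)] by force
    then have "(\<Sum>\<gamma>\<in>\<Delta>. (\<beta> \<bullet> \<omega> \<gamma>) *\<^sub>R \<gamma>) = (\<Sum>\<gamma>\<in>\<Delta>. if \<gamma> = \<alpha> then (\<beta> \<bullet> \<omega> \<alpha>) *\<^sub>R \<alpha> else 0)"
      by (intro sum.cong) auto
    then have b: "\<beta> = (\<beta> \<bullet> \<omega> \<alpha>) *\<^sub>R \<alpha>"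
      using assms(1) finite_simple simple_expansion[of \<beta>] by simp
    then have "\<beta> \<bullet> \<omega> \<alpha> = 1 \<or> \<beta> \<bullet> \<omega> \<alpha> = - 1"
      using reduced[OF simple_root[OF assms(1)], of "\<beta> \<bullet> \<omega> \<alpha>"] positive_root[OF assms(2)] by simp
    then have "\<beta> = \<alpha>" using b positive_coeff_ge_0[OF assms(2,1)]
      by (metis less_eq_real_def not_one_le_zero neg_0_le_iff_le order_antisym_conv scaleR_one zero_le_one)
    then show False using assms(3) by simp
  qed
  then obtain \<gamma> where g: "\<gamma> \<in> \<Delta>" "\<gamma> \<noteq> \<alpha>" "\<beta> \<bullet> \<omega> \<gamma> > 0" by blast
  show ?thesis
    by (rule positive_coeff_imp_positive[of _ \<gamma>])
      (use g assms simple_root positive_root in \<open>auto simp: simple_reflection_coeff reflection_root\<close>)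
qed

section \<open>Elements of the finite Weyl group\<close>

lemma simple_reflections_iff: "s \<in> simple_reflections \<Delta> \<longleftrightarrow> (\<exists>\<alpha>\<in>\<Delta>. s = \<sigma> \<alpha> 0)"
  unfolding simple_reflections_def by blast

lemma W_eq_words: "W = words (simple_reflections \<Delta>)"
  unfolding finite_weyl_group_def
  by (rule generate_involutions) (auto simp: simple_reflections_iff simple_root reflection_comp_self)

lemma W_id: "id \<in> W"
  unfolding W_eq_words by (rule id_in_words)

lemma W_comp: "\<lbrakk>f \<in> W; g \<in> W\<rbrakk> \<Longrightarrow> f \<circ> g \<in> W"
  unfolding W_eq_words by (rule words_comp)

lemma W_simple: "\<alpha> \<in> \<Delta> \<Longrightarrow> \<sigma> \<alpha> 0 \<in> W"
  unfolding W_eq_words by (rule generator_in_words) (auto simp: simple_reflections_iff)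

lemma W_induct [consumes 1, case_names id step]:
  assumes "f \<in> W" "P id"
    and "\<And>\<alpha> f. \<lbrakk>\<alpha> \<in> \<Delta>; f \<in> W; P f\<rbrakk> \<Longrightarrow> P (\<sigma> \<alpha> 0 \<circ> f)"
  shows "P f"
  using assms(1) unfolding W_eq_words
  by (rule words_induct)
    (use assms(2,3) in \<open>auto simp: simple_reflections_iff W_eq_words simp del: o_apply id_apply\<close>)

lemma W_inverse:
  assumes "f \<in> W"
  shows "bij f" "inv_into UNIV f \<in> W" "f (inv_into UNIV f x) = x" "inv_into UNIV f (f x) = x"
proof -
  obtain g where g: "g \<in> W" "f \<circ> g = id" "g \<circ> f = id"
    using words_inverse[of "simple_reflections \<Delta>" f] assms unfolding W_eq_words
    by (metis reflection_comp_self simple_reflections_iff simple_root)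
  show "bij f" using g o_bij by blast
  moreover have "inv_into UNIV f = g" using g(2,3) by (rule inv_unique_comp)
  ultimately show "inv_into UNIV f \<in> W" "f (inv_into UNIV f x) = x" "inv_into UNIV f (f x) = x"
    using g by (auto simp: bij_is_inj bij_is_surj surj_f_inv_f)
qed

lemma W_linear: "f \<in> W \<Longrightarrow> linear f"
  by (induction rule: W_induct) (auto intro: linear_compose[unfolded o_def] linear_reflection linear_ident)

lemma W_add: "f \<in> W \<Longrightarrow> f (x + y) = f x + f y"
  by (simp add: W_linear linear_add)

lemma W_minus: "f \<in> W \<Longrightarrow> f (- x) = - f x"
  by (simp add: W_linear linear_neg)

lemma W_scale: "f \<in> W \<Longrightarrow> f (c *\<^sub>R x) = c *\<^sub>R f x"
  by (simp add: W_linear linear_scale)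

lemma W_inner: "f \<in> W \<Longrightarrow> f x \<bullet> f y = x \<bullet> y"
  by (induction rule: W_induct)
    (auto simp: reflection_inner_commute hyperplane_reflection_involution root_nonzero simple_root)

lemma W_inner_left: "f \<in> W \<Longrightarrow> f x \<bullet> y = x \<bullet> inv_into UNIV f y"
  by (metis W_inner W_inverse(3))

lemma W_root: "\<lbrakk>f \<in> W; \<beta> \<in> \<Phi>\<rbrakk> \<Longrightarrow> f \<beta> \<in> \<Phi>"
  by (induction rule: W_induct) (auto simp: reflection_root simple_root)

lemma W_coroot: "f \<in> W \<Longrightarrow> f (coroot \<beta>) = coroot (f \<beta>)"
  unfolding coroot_def by (simp add: W_scale W_inner)

lemma W_conj_reflection: "f \<in> W \<Longrightarrow> f (\<sigma> \<alpha> 0 x) = \<sigma> (f \<alpha>) 0 (f x)"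
  unfolding hyperplane_reflection_def
  by (simp add: W_linear linear_diff linear_scale W_inner W_coroot)

text \<open>Linear maps that agree on the spanning set \<Phi> coincide, so an element is determined
  by its action on a finite set.\<close>

lemma W_finite: "finite W"
proof -
  have "inj_on (\<lambda>f. restrict f \<Phi>) W"
  proof (rule inj_onI)
    fix f g assume f: "f \<in> W" and g: "g \<in> W" and eq: "restrict f \<Phi> = restrict g \<Phi>"
    have "f \<beta> = g \<beta>" if "\<beta> \<in> \<Phi>" for \<beta>
      using eq that by (metis restrict_apply')
    then show "f = g"
      using linear_eq_on_span[OF W_linear[OF f] W_linear[OF g], of \<Phi>] spanning by auto
  qed
  moreover have "(\<lambda>f. restrict f \<Phi>) ` W \<subseteq> \<Phi> \<rightarrow>\<^sub>E \<Phi>"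
    using W_root by auto
  ultimately show ?thesis
    using finite_PiE[OF finite_roots, of "\<lambda>_. \<Phi>"] finite_roots inj_on_finite by blast
qed

text \<open>The height of a root, extended linearly to the whole space.\<close>

definition ht :: "'a \<Rightarrow> real" where
  "ht x = (\<Sum>\<gamma>\<in>\<Delta>. x \<bullet> \<omega> \<gamma>)"

lemma ht_simple_reflection: "\<alpha> \<in> \<Delta> \<Longrightarrow> ht (\<sigma> \<alpha> 0 x) = ht x - x \<bullet> coroot \<alpha>"
  unfolding ht_def using finite_simple by (simp add: simple_reflection_coeff sum_subtractf)

lemma ht_positive:
  assumes "\<beta> \<in> Pos" shows "0 < ht \<beta>"
proof (rule ccontr)
  assume "\<not> 0 < ht \<beta>"
  moreover have nn: "\<And>\<alpha>. \<alpha> \<in> \<Delta> \<Longrightarrow> 0 \<le> \<beta> \<bullet> \<omega> \<alpha>" using positive_coeff_ge_0[OF assms] .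
  ultimately have "(\<Sum>\<alpha>\<in>\<Delta>. \<beta> \<bullet> \<omega> \<alpha>) = 0"
    unfolding ht_def using sum_nonneg[of \<Delta> "\<lambda>\<alpha>. \<beta> \<bullet> \<omega> \<alpha>"] by force
  then have "\<forall>\<alpha>\<in>\<Delta>. \<beta> \<bullet> \<omega> \<alpha> = 0"
    using sum_nonneg_eq_0_iff[OF finite_simple, of "\<lambda>\<alpha>. \<beta> \<bullet> \<omega> \<alpha>"] nn by simp
  then have "\<beta> = 0" using simple_expansion[of \<beta>] by simp
  then show False using assms positive_root root_nonzero by blast
qed

text \<open>Induction on the height: reflecting a positive root in a simple root with which it has
  positive product lowers its height and keeps it positive, unless it is that simple root.\<close>

lemma positive_conj_simple:
  assumes "\<beta> \<in> Pos"
  shows "\<exists>f\<in>W. \<exists>\<alpha>\<in>\<Delta>. \<beta> = f \<alpha>"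
proof -
  have "\<exists>n. ht \<beta> = real n" if "\<beta> \<in> Pos" for \<beta>
  proof -
    have "ht \<beta> \<in> \<nat>"
      using that Ints_sum[of \<Delta> "\<lambda>\<gamma>. \<beta> \<bullet> \<omega> \<gamma>"] sum_nonneg[of \<Delta> "\<lambda>\<gamma>. \<beta> \<bullet> \<omega> \<gamma>"]
      unfolding ht_def Nats_altdef2 positive_iff by blast
    then show ?thesis by (auto elim: Nats_cases)
  qed
  then obtain n where "ht \<beta> = real n" using assms by blast
  then show ?thesis using assms
  proof (induction n arbitrary: \<beta> rule: less_induct)
    case (less n)
    have "\<beta> \<bullet> \<beta> > 0" using less.prems positive_root root_nonzero by simp
    \<comment> \<open>Expanding \<open>\<beta> \<bullet> \<beta>\<close> in the simple roots gives a
      positive sum, so one of its terms is positive.\<close>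
    then obtain \<alpha> where a: "\<alpha> \<in> \<Delta>" "(\<beta> \<bullet> \<omega> \<alpha>) * (\<alpha> \<bullet> \<beta>) > 0"
      using inner_simple_expansion[of \<beta> \<beta>] sum_nonpos[of \<Delta> "\<lambda>\<alpha>. (\<beta> \<bullet> \<omega> \<alpha>) * (\<alpha> \<bullet> \<beta>)"] by force
    then have ab: "\<beta> \<bullet> \<alpha> > 0"
      using positive_coeff_ge_0[OF less.prems(2) a(1)] by (auto simp: zero_less_mult_iff inner_commute)
    show ?case
    proof (cases "\<beta> = \<alpha>")
      case True
      then show ?thesis using a(1) W_id by (metis id_apply)
    next
      case False
      let ?b = "\<sigma> \<alpha> 0 \<beta>"
      have pos: "?b \<in> Pos" using simple_reflection_positive[OF a(1) less.prems(2) False] .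
      then obtain m where m: "ht ?b = real m" using \<open>\<And>\<beta>. \<beta> \<in> Pos \<Longrightarrow> \<exists>n. ht \<beta> = real n\<close> by blast
      have "ht ?b = ht \<beta> - \<beta> \<bullet> coroot \<alpha>" using ht_simple_reflection[OF a(1)] .
      moreover have "\<beta> \<bullet> coroot \<alpha> > 0"
        using ab root_nonzero[OF simple_root[OF a(1)]] by (simp add: coroot_def)
      ultimately have "m < n" using m less.prems(1) by simp
      from less.IH[OF this m pos] obtain f \<gamma> where f: "f \<in> W" "\<gamma> \<in> \<Delta>" "?b = f \<gamma>" by blast
      then have "\<beta> = (\<sigma> \<alpha> 0 \<circ> f) \<gamma>"
        using hyperplane_reflection_involution[OF root_nonzero[OF simple_root[OF a(1)]], of 0 \<beta>] by simp
      then show ?thesis using W_comp[OF W_simple[OF a(1)] f(1)] f(2) by blast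
    qed
  qed
qed

lemma root_conj_simple:
  assumes "\<beta> \<in> \<Phi>"
  shows "\<exists>f\<in>W. \<exists>\<alpha>\<in>\<Delta>. \<beta> = f \<alpha>"
proof (cases "\<beta> \<in> Pos")
  case True
  then show ?thesis by (rule positive_conj_simple)
next
  case False
  then have "- \<beta> \<in> Pos" using root_cases assms by blast
  then obtain f \<alpha> where f: "f \<in> W" "\<alpha> \<in> \<Delta>" "- \<beta> = f \<alpha>" using positive_conj_simple by blast
  then have "\<beta> = (f \<circ> \<sigma> \<alpha> 0) \<alpha>"
    using reflection_self[OF simple_root[OF f(2)]] W_minus[OF f(1)] by (metis comp_apply minus_minus)
  then show ?thesis using W_comp[OF f(1) W_simple[OF f(2)]] f(2) by blast
qed

text \<open>The reflection in \<open>f \<alpha>\<close> is the conjugate by \<open>f\<close> of the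
  reflection in \<alpha>, and every root is conjugate to a simple one.\<close>

lemma W_reflection:
  assumes "\<beta> \<in> \<Phi>" shows "\<sigma> \<beta> 0 \<in> W"
proof -
  obtain f \<alpha> where f: "f \<in> W" "\<alpha> \<in> \<Delta>" "\<beta> = f \<alpha>" using root_conj_simple[OF assms] by blast
  have "\<sigma> \<beta> 0 = f \<circ> \<sigma> \<alpha> 0 \<circ> inv_into UNIV f"
    by (simp add: fun_eq_iff W_conj_reflection[OF f(1)] W_inverse[OF f(1)] f(3))
  then show ?thesis using W_comp W_inverse(2) W_simple f by metis
qed

section \<open>The coroot lattice and the affine Weyl group\<close>

lemma Q_add: "\<lbrakk>x \<in> Q; y \<in> Q\<rbrakk> \<Longrightarrow> x + y \<in> Q"
proof -
  assume "x \<in> Q" "y \<in> Q"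
  then obtain c d :: "'a \<Rightarrow> int" where
    "x = (\<Sum>\<alpha>\<in>\<Phi>. of_int (c \<alpha>) *\<^sub>R coroot \<alpha>)" "y = (\<Sum>\<alpha>\<in>\<Phi>. of_int (d \<alpha>) *\<^sub>R coroot \<alpha>)"
    unfolding coroot_lattice_def by blast
  then have "x + y = (\<Sum>\<alpha>\<in>\<Phi>. of_int (c \<alpha> + d \<alpha>) *\<^sub>R coroot \<alpha>)"
    by (simp add: scaleR_left_distrib sum.distrib)
  then show ?thesis unfolding coroot_lattice_def by (intro range_eqI[of _ _ "\<lambda>\<alpha>. c \<alpha> + d \<alpha>"])
qed

lemma Q_zero: "0 \<in> Q"
  unfolding coroot_lattice_def by (rule range_eqI[of _ _ "\<lambda>_. 0"]) simp

lemma Q_scale_coroot: "\<alpha> \<in> \<Phi> \<Longrightarrow> of_int c *\<^sub>R coroot \<alpha> \<in> Q"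
proof -
  assume a: "\<alpha> \<in> \<Phi>"
  have "(\<Sum>\<beta>\<in>\<Phi>. of_int (if \<beta> = \<alpha> then c else 0) *\<^sub>R coroot \<beta>)
      = (\<Sum>\<beta>\<in>\<Phi>. if \<beta> = \<alpha> then of_int c *\<^sub>R coroot \<alpha> else 0)"
    by (intro sum.cong) auto
  also have "\<dots> = of_int c *\<^sub>R coroot \<alpha>" using a finite_roots by simp
  finally show ?thesis
    unfolding coroot_lattice_def by (intro range_eqI[of _ _ "\<lambda>\<beta>. if \<beta> = \<alpha> then c else 0"]) simp
qed

lemma Q_scale_coroot_Ints: "\<lbrakk>\<alpha> \<in> \<Phi>; k \<in> \<int>\<rbrakk> \<Longrightarrow> k *\<^sub>R coroot \<alpha> \<in> Q"
  using Q_scale_coroot by (auto elim!: Ints_cases)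

lemma Q_induct [consumes 1, case_names zero add coroot]:
  assumes "x \<in> Q" "P 0" "\<And>x y. \<lbrakk>P x; P y\<rbrakk> \<Longrightarrow> P (x + y)"
    "\<And>\<alpha> c. \<alpha> \<in> \<Phi> \<Longrightarrow> P (of_int c *\<^sub>R coroot \<alpha>)"
  shows "P x"
proof -
  obtain c :: "'a \<Rightarrow> int" where x: "x = (\<Sum>\<alpha>\<in>\<Phi>. of_int (c \<alpha>) *\<^sub>R coroot \<alpha>)"
    using assms(1) unfolding coroot_lattice_def by blast
  have "P (\<Sum>\<alpha>\<in>A. of_int (c \<alpha>) *\<^sub>R coroot \<alpha>)" if "finite A" "A \<subseteq> \<Phi>" for A
    using that by (induction A rule: finite_induct) (use assms(2-4) in auto)
  then show ?thesis using x finite_roots by blast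
qed

lemma Q_minus: "x \<in> Q \<Longrightarrow> - x \<in> Q"
proof (induction rule: Q_induct)
  case zero
  show ?case by (simp add: Q_zero)
next
  case (add x y)
  then show ?case using Q_add[of "- x" "- y"] by (simp add: add.commute)
next
  case (coroot \<alpha> c)
  then show ?case using Q_scale_coroot[of \<alpha> "- c"] by simp
qed

lemma Q_diff: "\<lbrakk>x \<in> Q; y \<in> Q\<rbrakk> \<Longrightarrow> x - y \<in> Q"
  using Q_add[OF _ Q_minus] by fastforce

lemma Q_inner: "\<lbrakk>x \<in> Q; \<beta> \<in> \<Phi>\<rbrakk> \<Longrightarrow> x \<bullet> \<beta> \<in> \<int>"
proof (induction rule: Q_induct)
  case (coroot \<alpha> c)
  then show ?case using crystallographic[of \<alpha> \<beta>] by (simp add: inner_commute)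
qed (auto simp: inner_add_left)

lemma W_Q:
  assumes "f \<in> W" "x \<in> Q"
  shows "f x \<in> Q"
  using assms(2)
proof (induction rule: Q_induct)
  case zero
  show ?case using assms(1) by (simp add: W_linear linear_0 Q_zero)
next
  case (coroot \<alpha> c)
  then show ?case using assms(1) by (simp add: W_scale W_coroot Q_scale_coroot W_root)
qed (use assms(1) in \<open>auto simp: W_add Q_add\<close>)

text \<open>Each simple reflection subtracts an integral multiple of a coroot from a coweight, so
  the finite Weyl group acts trivially on coweights modulo the coroot lattice.\<close>

lemma W_coweight_diff:
  assumes "f \<in> W" "\<And>\<beta>. \<beta> \<in> \<Phi> \<Longrightarrow> x \<bullet> \<beta> \<in> \<int>"
  shows "x - f x \<in> Q"
  using assms(1)
proof (induction rule: W_induct)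
  case id
  show ?case by (simp add: Q_zero)
next
  case (step \<alpha> f)
  have "f x \<bullet> \<alpha> \<in> \<int>"
    using assms(2) W_inner_left W_root W_inverse(2) simple_root step by metis
  then have "(f x \<bullet> \<alpha>) *\<^sub>R coroot \<alpha> \<in> Q" using Q_scale_coroot_Ints simple_root step by blast
  then have "x - f x + (f x \<bullet> \<alpha>) *\<^sub>R coroot \<alpha> \<in> Q" using step Q_add by blast
  then show ?case by (simp add: hyperplane_reflection_def algebra_simps)
qed

text \<open>The semidirect product form of the affine Weyl group. Maps of this form are closed under
  composition because the finite group preserves the coroot lattice.\<close>

lemma Wa_iff: "g \<in> Wa \<longleftrightarrow> (\<exists>x\<in>Q. \<exists>f\<in>W. g = (\<lambda>v. x + f v))"
proof
  let ?T = "W \<union> (+) ` Q"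
  have bijT: "\<And>s. s \<in> ?T \<Longrightarrow> bij s"
    using W_inverse(1) bij_translation by auto
  assume "g \<in> Wa"
  then show "\<exists>x\<in>Q. \<exists>f\<in>W. g = (\<lambda>v. x + f v)"
    unfolding affine_weyl_group_def
  proof (induction rule: generate.induct)
    case one
    show ?case unfolding BijGroup_one using Q_zero W_id
      by (intro bexI[of _ 0] bexI[of _ id]) auto
  next
    case (incl h)
    then show ?case
    proof
      assume "h \<in> W"
      then show ?case using Q_zero by (intro bexI[of _ 0] bexI[of _ h]) auto
    next
      assume "h \<in> (+) ` Q"
      then obtain x where "x \<in> Q" "h = (+) x" by blast
      then show ?case using W_id by (intro bexI[of _ x] bexI[of _ id]) auto
    qed
  next
    case (inv h)
    have i: "inv\<^bsub>BijGroup UNIV\<^esub> h = inv_into UNIV h" using BijGroup_inv bijT inv by blast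
    from inv show ?case unfolding i
    proof
      assume "h \<in> W"
      then show "\<exists>x\<in>Q. \<exists>f\<in>W. inv_into UNIV h = (\<lambda>v. x + f v)"
        using Q_zero W_inverse(2) by (intro bexI[of _ 0] bexI[of _ "inv_into UNIV h"]) auto
    next
      assume "h \<in> (+) ` Q"
      then obtain x where "x \<in> Q" "h = (+) x" by blast
      then show "\<exists>x\<in>Q. \<exists>f\<in>W. inv_into UNIV h = (\<lambda>v. x + f v)"
        using W_id Q_minus
        by (intro bexI[of _ "- x"] bexI[of _ id]) (auto simp: inv_translation)
    qed
  next
    case (eng g h)
    have b: "bij g" "bij h" using eng(1,2) generate_bij[OF bijT] by metis+
    obtain x f y e where xf: "x \<in> Q" "f \<in> W" "g = (\<lambda>v. x + f v)"
      and ye: "y \<in> Q" "e \<in> W" "h = (\<lambda>v. y + e v)"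
      using eng(3,4) by blast
    have "g \<circ> h = (\<lambda>v. (x + f y) + (f \<circ> e) v)"
      using xf ye by (auto simp: fun_eq_iff W_add)
    then show ?case unfolding BijGroup_mult[OF b]
      using Q_add[OF xf(1) W_Q[OF xf(2) ye(1)]] W_comp[OF xf(2) ye(2)] by blast
  qed
next
  assume "\<exists>x\<in>Q. \<exists>f\<in>W. g = (\<lambda>v. x + f v)"
  then obtain x f where xf: "x \<in> Q" "f \<in> W" "g = (\<lambda>v. x + f v)" by blast
  have "(+) x \<otimes>\<^bsub>BijGroup UNIV\<^esub> f \<in> Wa"
    unfolding affine_weyl_group_def
    by (intro generate.eng generate.incl) (use xf in auto)
  moreover have "(+) x \<otimes>\<^bsub>BijGroup UNIV\<^esub> f = g"
    using BijGroup_mult[OF bij_translation W_inverse(1)[OF xf(2)], of x] xf(3) by (auto simp: fun_eq_iff)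
  ultimately show "g \<in> Wa" by simp
qed

lemma W_subset_Wa: "f \<in> W \<Longrightarrow> f \<in> Wa"
  unfolding Wa_iff using Q_zero by (intro bexI[of _ 0] bexI[of _ f]) auto

lemma Wa_id: "id \<in> Wa"
  using W_id W_subset_Wa by blast

lemma Wa_comp:
  assumes "g \<in> Wa" "h \<in> Wa" shows "g \<circ> h \<in> Wa"
proof -
  obtain x f y e where xf: "x \<in> Q" "f \<in> W" "g = (\<lambda>v. x + f v)"
    and ye: "y \<in> Q" "e \<in> W" "h = (\<lambda>v. y + e v)"
    using assms unfolding Wa_iff by blast
  have "g \<circ> h = (\<lambda>v. (x + f y) + (f \<circ> e) v)"
    using xf ye by (auto simp: fun_eq_iff W_add)
  then show ?thesis unfolding Wa_iff
    using Q_add[OF xf(1) W_Q[OF xf(2) ye(1)]] W_comp[OF xf(2) ye(2)] by blast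
qed

lemma Wa_inverse:
  assumes "g \<in> Wa"
  shows "bij g" "inv_into UNIV g \<in> Wa" "g (inv_into UNIV g x) = x" "inv_into UNIV g (g x) = x"
proof -
  obtain y f where yf: "y \<in> Q" "f \<in> W" "g = (\<lambda>v. y + f v)" using assms unfolding Wa_iff by blast
  let ?f = "inv_into UNIV f"
  let ?h = "\<lambda>v. - ?f y + ?f v"
  have i: "?f \<in> W" using W_inverse(2) yf(2) by blast
  have gh: "g \<circ> ?h = id" "?h \<circ> g = id"
    using yf W_inverse(3,4)[OF yf(2)] by (auto simp: fun_eq_iff W_linear linear_diff linear_add i)
  show "bij g" using gh o_bij by blast
  moreover have e: "inv_into UNIV g = ?h" using gh by (rule inv_unique_comp)
  moreover have "?h \<in> Wa" unfolding Wa_iff using i Q_minus[OF W_Q[OF i yf(1)]] by blast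
  ultimately show "inv_into UNIV g \<in> Wa" "g (inv_into UNIV g x) = x" "inv_into UNIV g (g x) = x"
    by (metis, metis bij_is_surj surj_f_inv_f, metis bij_is_inj inv_f_f)
qed

lemma Wa_reflection: "\<lbrakk>\<alpha> \<in> \<Phi>; k \<in> \<int>\<rbrakk> \<Longrightarrow> \<sigma> \<alpha> k \<in> Wa"
  unfolding Wa_iff
  by (intro bexI[of _ "k *\<^sub>R coroot \<alpha>"] bexI[of _ "\<sigma> \<alpha> 0"])
    (auto simp: Q_scale_coroot_Ints W_reflection fun_eq_iff intro: hyperplane_reflection_affine)

text \<open>Write \<open>g\<close> as a translation by \<open>x\<close> after a linear
  \<open>f\<close>. The root pulls back along \<open>f\<close>, and the level drops by
  \<open>x \<bullet> \<alpha>\<close>, an integer because \<open>x\<close> is in the coroot lattice.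
  Hence hyperplanes pull back to hyperplanes with their sides preserved.\<close>

lemma Wa_pull_back:
  assumes "g \<in> Wa" "\<alpha> \<in> \<Phi>" "k \<in> \<int>"
  obtains \<beta> m where "\<beta> \<in> \<Phi>" "m \<in> \<int>" "g \<circ> \<sigma> \<beta> m = \<sigma> \<alpha> k \<circ> g" "\<And>v. g v \<bullet> \<alpha> - k = v \<bullet> \<beta> - m"
proof -
  obtain x f where xf: "x \<in> Q" "f \<in> W" "g = (\<lambda>v. x + f v)" using assms(1) unfolding Wa_iff by blast
  define \<beta> where "\<beta> = inv_into UNIV f \<alpha>"
  have b: "\<beta> \<in> \<Phi>" unfolding \<beta>_def using W_root W_inverse(2) xf(2) assms(2) by blast
  have fb: "f \<beta> = \<alpha>" unfolding \<beta>_def using W_inverse(3)[OF xf(2)] .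
  have inner: "g v \<bullet> \<alpha> - k = v \<bullet> \<beta> - (k - x \<bullet> \<alpha>)" for v
    using xf(3) W_inner[OF xf(2), of v \<beta>] fb by (simp add: inner_add_left)
  have "g (\<sigma> \<beta> (k - x \<bullet> \<alpha>) v) = \<sigma> \<alpha> k (g v)" for v
  proof -
    have "g (\<sigma> \<beta> (k - x \<bullet> \<alpha>) v) = x + f v - (v \<bullet> \<beta> - (k - x \<bullet> \<alpha>)) *\<^sub>R coroot \<alpha>"
      unfolding hyperplane_reflection_def xf(3)
      by (simp add: W_linear[OF xf(2)] linear_diff linear_scale W_coroot[OF xf(2)] fb)
    also have "\<dots> = \<sigma> \<alpha> k (g v)" unfolding hyperplane_reflection_def inner[of v] by (simp add: xf(3))
    finally show ?thesis .
  qed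
  then have "g \<circ> \<sigma> \<beta> (k - x \<bullet> \<alpha>) = \<sigma> \<alpha> k \<circ> g" by (simp add: fun_eq_iff)
  moreover have "k - x \<bullet> \<alpha> \<in> \<int>" using assms(3) Q_inner[OF xf(1) assms(2)] by (rule Ints_diff)
  ultimately show ?thesis using that b inner by blast
qed

lemma Wa_push_forward:
  assumes "g \<in> Wa" "\<beta> \<in> \<Phi>" "m \<in> \<int>"
  obtains \<alpha> k where "\<alpha> \<in> \<Phi>" "k \<in> \<int>" "g \<circ> \<sigma> \<beta> m = \<sigma> \<alpha> k \<circ> g"
proof -
  obtain \<alpha> k where a: "\<alpha> \<in> \<Phi>" "k \<in> \<int>"
    "inv_into UNIV g \<circ> \<sigma> \<alpha> k = \<sigma> \<beta> m \<circ> inv_into UNIV g"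
    using Wa_pull_back[OF Wa_inverse(2)[OF assms(1)] assms(2,3)] by metis
  have "g (\<sigma> \<beta> m v) = \<sigma> \<alpha> k (g v)" for v
    using fun_cong[OF a(3), of "g v"] Wa_inverse(3,4)[OF assms(1)] by (metis comp_apply)
  then show ?thesis using that a(1,2) by (auto simp: fun_eq_iff)
qed


section \<open>Galleries and the exchange property\<close>

abbreviation A0 where "A0 \<equiv> fundamental_alcove \<Phi> \<Delta>"

text \<open>A vector having product 1 with every simple root pairs with a positive root to its
  height. Dividing it by a bound above all these heights and changing its sign moves it into the
  alcove.\<close>

lemma fundamental_alcove_nonempty: "A0 \<noteq> {}"
proof -
  obtain x where x: "\<forall>\<beta>\<in>\<Delta>. x \<bullet> \<beta> = 1" using prescribed_inner[of "\<lambda>_. 1"] by blast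
  have pos: "x \<bullet> \<beta> > 0" if b: "\<beta> \<in> Pos" for \<beta>
  proof -
    have "x \<bullet> \<beta> = ht \<beta>"
      unfolding ht_def inner_commute[of x] inner_simple_expansion[of \<beta> x] using x by (simp add: inner_commute)
    then show ?thesis using ht_positive[OF b] by simp
  qed
  define M where "M = (\<Sum>\<beta>\<in>Pos. x \<bullet> \<beta>) + 1"
  have fin: "finite Pos" using finite_roots unfolding positive_roots_def by blast
  have M: "x \<bullet> \<beta> < M" if "\<beta> \<in> Pos" for \<beta>
    unfolding M_def using member_le_sum[OF that _ fin, of "\<lambda>\<beta>. x \<bullet> \<beta>"] pos by force
  have "M > 0" unfolding M_def using pos sum_nonneg[of Pos "\<lambda>\<beta>. x \<bullet> \<beta>"] by force
  then have "(- 1 / M) *\<^sub>R x \<in> A0"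
    using pos M unfolding fundamental_alcove_def by (auto simp: divide_simps)
  then show ?thesis by blast
qed

text \<open>A fixed interior point of the base alcove. The side of a hyperplane on which an alcove
  lies is read off from the corresponding image of this point.\<close>

definition p0 where "p0 = (SOME p. p \<in> A0)"

lemma p0: "p0 \<in> A0"
  unfolding p0_def using fundamental_alcove_nonempty by (simp add: some_in_eq)

lemma alcove_pos: "\<lbrakk>p \<in> A0; \<beta> \<in> Pos\<rbrakk> \<Longrightarrow> - 1 < p \<bullet> \<beta> \<and> p \<bullet> \<beta> < 0"
  unfolding fundamental_alcove_def by blast

lemma alcove_root:
  assumes "p \<in> A0" "\<beta> \<in> \<Phi>"
  shows "\<bar>p \<bullet> \<beta>\<bar> < 1" "p \<bullet> \<beta> \<noteq> 0"
  using root_cases[OF assms(2)] alcove_pos[OF assms(1), of \<beta>] alcove_pos[OF assms(1), of "- \<beta>"] by auto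

text \<open>On the whole alcove a root takes values in one open unit interval with integral ends,
  and no integer lies strictly inside it.\<close>

lemma alcove_same_side:
  assumes "p \<in> A0" "q \<in> A0" "\<beta> \<in> \<Phi>" "k \<in> \<int>" "p \<bullet> \<beta> < k"
  shows "q \<bullet> \<beta> < k"
  using root_cases[OF assms(3)]
proof
  assume b: "\<beta> \<in> Pos"
  have "k \<ge> 0"
    using Ints_strictly_between[OF assms(4), of "- 1"] alcove_pos[OF assms(1) b] assms(5) by force
  then show ?thesis using alcove_pos[OF assms(2) b] by linarith
next
  assume b: "- \<beta> \<in> Pos"
  have "k \<ge> 1"
    using Ints_strictly_between[OF assms(4), of 0] alcove_pos[OF assms(1) b] assms(5) by force
  then show ?thesis using alcove_pos[OF assms(2) b] by simp
qed

text \<open>A hyperplane through \<open>g p0\<close> would pull back to one through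
  \<open>p0\<close>, where roots take nonzero values smaller than 1 in absolute value. So
  comparisons of images of \<open>p0\<close> with hyperplanes are always strict.\<close>

lemma Wa_base_not_Ints:
  assumes "g \<in> Wa" "\<alpha> \<in> \<Phi>" shows "g p0 \<bullet> \<alpha> \<notin> \<int>"
proof
  assume "g p0 \<bullet> \<alpha> \<in> \<int>"
  from Wa_pull_back[OF assms this] obtain \<beta> m where "\<beta> \<in> \<Phi>" "m \<in> \<int>" "p0 \<bullet> \<beta> = m"
    by (metis diff_self eq_iff_diff_eq_0)
  then show False using alcove_root[OF p0] Ints_nonzero_abs_less1 by metis
qed

text \<open>The pairs \<open>(\<beta>, m)\<close> and \<open>(- \<beta>, - m)\<close> describe the same hyperplane; orienting it so that \<open>p0\<close> lies
  on its negative side makes the separating pair unique.\<close>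

definition wall :: "'a \<Rightarrow> real \<Rightarrow> bool" where
  "wall \<beta> m \<longleftrightarrow> \<beta> \<in> \<Phi> \<and> m \<in> \<int> \<and> p0 \<bullet> \<beta> < m \<and>
     (\<forall>\<gamma>\<in>\<Phi>. \<forall>k\<in>\<int>. p0 \<bullet> \<gamma> < k \<longrightarrow> k < \<sigma> \<beta> m p0 \<bullet> \<gamma> \<longrightarrow> \<gamma> = \<beta> \<and> k = m)"

text \<open>The condition that the exchange argument puts on a generating set; it serves the finite
  and the affine group alike.\<close>

definition wall_reflections :: "('a \<Rightarrow> 'a) set \<Rightarrow> bool" where
  "wall_reflections S \<longleftrightarrow> (\<forall>s\<in>S. \<exists>\<beta> m. wall \<beta> m \<and> s = \<sigma> \<beta> m)"

lemma wall_reflections_Wa: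
  assumes "wall_reflections S" "w \<in> words S" shows "w \<in> Wa"
  using assms(2)
proof (induction rule: words_induct)
  case id
  show ?case by (rule Wa_id)
next
  case (step s f)
  then obtain \<beta> m where "wall \<beta> m" "s = \<sigma> \<beta> m"
    using assms(1) unfolding wall_reflections_def by blast
  then have "s \<in> Wa" using Wa_reflection unfolding wall_def by simp
  then show ?case using step(3) by (rule Wa_comp)
qed

text \<open>A word describes a gallery starting at the base alcove. A hyperplane separating its two
  ends is crossed at some letter, and carried back along the letters before it this hyperplane is
  the wall of that letter.\<close>

lemma exchange:
  assumes S: "wall_reflections S"
  shows "\<lbrakk>set ss \<subseteq> S; \<alpha> \<in> \<Phi>; k \<in> \<int>; p0 \<bullet> \<alpha> < k; k < word_prod ss p0 \<bullet> \<alpha>\<rbrakk>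
    \<Longrightarrow> \<exists>xs s ys. ss = xs @ s # ys \<and> \<sigma> \<alpha> k \<circ> word_prod xs = word_prod xs \<circ> s"
proof (induction ss arbitrary: \<alpha> k)
  case Nil
  then show ?case by (simp add: word_prod_Nil)
next
  case (Cons s ss)
  obtain \<beta> m where w: "wall \<beta> m" "s = \<sigma> \<beta> m"
    using Cons.prems(1) S unfolding wall_reflections_def by auto
  have sWa: "s \<in> Wa" using w Wa_reflection unfolding wall_def by blast
  show ?case
  proof (cases "k < s p0 \<bullet> \<alpha>")
    case True
    \<comment> \<open>The first letter already crosses the hyperplane, and only its own wall
      separates \<open>p0\<close> from \<open>s p0\<close>.\<close>
    then have "\<sigma> \<alpha> k = s" using w Cons.prems unfolding wall_def by blast
    then have "s # ss = [] @ s # ss \<and> \<sigma> \<alpha> k \<circ> word_prod [] = word_prod [] \<circ> s"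
      by (simp add: word_prod_Nil)
    then show ?thesis by blast
  next
    case False
    then have lt: "s p0 \<bullet> \<alpha> < k"
      using Wa_base_not_Ints[OF sWa Cons.prems(2)] Cons.prems(3) by (metis linorder_neqE_linordered_idom)
    obtain \<gamma> j where g: "\<gamma> \<in> \<Phi>" "j \<in> \<int>" "s \<circ> \<sigma> \<gamma> j = \<sigma> \<alpha> k \<circ> s"
      and eq: "\<And>v. s v \<bullet> \<alpha> - k = v \<bullet> \<gamma> - j"
      using Wa_pull_back[OF sWa Cons.prems(2,3)] by metis
    \<comment> \<open>The first letter does not cross the hyperplane, so the pullback along
      \<open>s\<close> separates \<open>p0\<close> from the end of the remaining word.\<close>
    have "p0 \<bullet> \<gamma> < j" "j < word_prod ss p0 \<bullet> \<gamma>"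
      using eq[of p0] eq[of "word_prod ss p0"] lt Cons.prems(5)[unfolded word_prod_Cons comp_apply] by linarith+
    moreover have "set ss \<subseteq> S" using Cons.prems(1) by simp
    ultimately obtain xs t ys
      where x: "ss = xs @ t # ys" "\<sigma> \<gamma> j \<circ> word_prod xs = word_prod xs \<circ> t"
      using Cons.IH[OF _ g(1,2)] by blast
    have "\<sigma> \<alpha> k \<circ> word_prod (s # xs) = s \<circ> (\<sigma> \<gamma> j \<circ> word_prod xs)"
      unfolding word_prod_Cons using g(3) by (metis comp_assoc)
    also have "\<dots> = word_prod (s # xs) \<circ> t"
      unfolding x(2) word_prod_Cons by (simp only: comp_assoc)
    finally show ?thesis using x(1) by (metis append_Cons)
  qed
qed

text \<open>In a shortest word, the letter found by \<open>exchange\<close> cancels against itself,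
  leaving the same word with that letter deleted.\<close>

lemma exchange_length:
  assumes S: "wall_reflections S" and "w \<in> words S" and "\<alpha> \<in> \<Phi>" "k \<in> \<int>"
    and "p0 \<bullet> \<alpha> < k" "k < w p0 \<bullet> \<alpha>"
  shows "word_length S (\<sigma> \<alpha> k \<circ> w) < word_length S w"
proof -
  obtain ss where ss: "set ss \<subseteq> S" "length ss = word_length S w" "word_prod ss = w"
    using word_length_attained[OF assms(2)] .
  obtain xs s ys where x: "ss = xs @ s # ys" "\<sigma> \<alpha> k \<circ> word_prod xs = word_prod xs \<circ> s"
    using exchange[OF S ss(1) assms(3-5)] assms(6) ss(3) by blast
  have "s \<in> S" using ss(1) x(1) by simp
  then have inv: "s \<circ> s = id"
    using S reflection_comp_self unfolding wall_reflections_def wall_def by metis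
  have "w = word_prod xs \<circ> (s \<circ> word_prod ys)"
    using ss(3) x(1) by (metis word_prod_append word_prod_Cons)
  then have "\<sigma> \<alpha> k \<circ> w = word_prod xs \<circ> (s \<circ> s) \<circ> word_prod ys"
    using x(2) by (metis comp_assoc)
  then have "\<sigma> \<alpha> k \<circ> w = word_prod (xs @ ys)" unfolding inv word_prod_append by simp
  then show ?thesis using word_length_le[of "xs @ ys" S] ss(1,2) x(1) by simp
qed

text \<open>The reflection moves \<open>w p0\<close> beyond the hyperplane, so
  \<open>exchange_length\<close> applies to the reflected element and leads back to
  \<open>w\<close>.\<close>

lemma length_less_reflected:
  assumes S: "wall_reflections S" and "w \<in> words S" "\<sigma> \<alpha> k \<circ> w \<in> words S" and "\<alpha> \<in> \<Phi>" "k \<in> \<int>"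
    and "p0 \<bullet> \<alpha> < k" "w p0 \<bullet> \<alpha> < k"
  shows "word_length S w < word_length S (\<sigma> \<alpha> k \<circ> w)"
proof -
  have "k < (\<sigma> \<alpha> k \<circ> w) p0 \<bullet> \<alpha>"
    using hyperplane_reflection_inner_self[OF root_nonzero[OF assms(4)], of k "w p0"] assms(7) by simp
  from exchange_length[OF S assms(3-6) this] show ?thesis
    using reflection_comp_self[OF assms(4), of k] by (metis comp_assoc id_comp)
qed

text \<open>Suppose a shortest word for \<open>w\<close> has a first letter. Its wall does not
  separate \<open>p0\<close> from \<open>w p0\<close>, so multiplying by that letter raises the
  length, yet the result is the word without its first letter.\<close>

lemma words_regular:
  assumes S: "wall_reflections S" and "w \<in> words S" "w p0 \<in> A0"
  shows "w = id"
proof -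
  obtain ss where ss: "set ss \<subseteq> S" "length ss = word_length S w" "word_prod ss = w"
    using word_length_attained[OF assms(2)] .
  show ?thesis
  proof (cases ss)
    case Nil
    then show ?thesis using ss(3) word_prod_Nil by blast
  next
    case (Cons s ys)
    obtain \<beta> m where w: "wall \<beta> m" "s = \<sigma> \<beta> m"
      using ss(1) Cons S unfolding wall_reflections_def by auto
    have sub: "set ys \<subseteq> S" using ss(1) Cons by simp
    have "s \<circ> w = word_prod ys"
      using ss(3) Cons reflection_comp_self[of \<beta> m] w unfolding wall_def
      by (metis comp_assoc id_comp word_prod_Cons)
    moreover have "word_prod ys \<in> words S" unfolding words_def using sub by blast
    moreover have "w p0 \<bullet> \<beta> < m"
      using alcove_same_side[OF p0 assms(3)] w(1) unfolding wall_def by blast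
    ultimately have "word_length S w < word_length S (word_prod ys)"
      using length_less_reflected[OF S assms(2), of \<beta> m] w unfolding wall_def by metis
    then show ?thesis using word_length_le[OF sub] ss(2) Cons by simp
  qed
qed

section \<open>Dominance and the longest element\<close>

text \<open>The reflection permutes the positive roots other than \<alpha>. On these, both
  \<open>p0\<close> and its mirror image have values strictly between -1 and 0, so no further
  hyperplane runs between the two points.\<close>

lemma wall_simple:
  assumes "\<alpha> \<in> \<Delta>" shows "wall \<alpha> 0"
  unfolding wall_def
proof (intro conjI ballI impI)
  show "\<alpha> \<in> \<Phi>" using assms simple_root by blast
  show "0 \<in> (\<int>::real set)" by simp
  show a: "p0 \<bullet> \<alpha> < 0" using alcove_pos[OF p0 simple_positive[OF assms]] by simp
  fix \<gamma> k assume g: "\<gamma> \<in> \<Phi>" "k \<in> (\<int>::real set)" "p0 \<bullet> \<gamma> < k" "k < \<sigma> \<alpha> 0 p0 \<bullet> \<gamma>"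
  then have k: "k < p0 \<bullet> \<sigma> \<alpha> 0 \<gamma>" by (simp add: reflection_inner_commute)
  have refl: "\<sigma> \<alpha> 0 \<alpha> = - \<alpha>" using reflection_self simple_root assms by blast
  have "\<gamma> = \<alpha> \<and> k = 0"
  proof (cases "\<gamma> = \<alpha>")
    case True
    then show ?thesis using k g(2,3) refl alcove_pos[OF p0 simple_positive[OF assms]]
      by (auto intro: Ints_between_minus1_1)
  next
    case False
    show ?thesis using root_cases[OF g(1)]
    proof
      assume "\<gamma> \<in> Pos"
      then have "- 1 < p0 \<bullet> \<gamma>" "p0 \<bullet> \<sigma> \<alpha> 0 \<gamma> < 0"
        using alcove_pos[OF p0] simple_reflection_positive[OF assms _ False] by blast+
      then show ?thesis using Ints_strictly_between[OF g(2), of "- 1"] k g(3) by force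
    next
      assume n: "- \<gamma> \<in> Pos"
      have m: "\<sigma> \<alpha> 0 (- \<gamma>) = - \<sigma> \<alpha> 0 \<gamma>" by (simp add: linear_reflection linear_neg)
      show ?thesis
      proof (cases "- \<gamma> = \<alpha>")
        case True
        then show ?thesis using k g(3) m refl a
          by (metis add.inverse_inverse inner_minus_right less_trans neg_less_0_iff_less order_less_asym)
      next
        case False
        have "p0 \<bullet> \<sigma> \<alpha> 0 \<gamma> < 1" "0 < p0 \<bullet> \<gamma>"
          using alcove_pos[OF p0 n] alcove_pos[OF p0 simple_reflection_positive[OF assms n False]] m
          by simp_all
        then show ?thesis using Ints_strictly_between[OF g(2), of 0] k g(3) by force
      qed
    qed
  qed
  then show "\<gamma> = \<alpha>" "k = 0" by simp_all
qed

lemma simple_wall_reflections: "wall_reflections (simple_reflections \<Delta>)"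
  using wall_simple simple_reflections_iff unfolding wall_reflections_def by metis

lemma W_regular: "\<lbrakk>f \<in> W; f p0 \<in> A0\<rbrakk> \<Longrightarrow> f = id"
  using words_regular[OF simple_wall_reflections] W_eq_words by blast

definition dominant :: "'a \<Rightarrow> bool" where
  "dominant x \<longleftrightarrow> (\<forall>\<alpha>\<in>\<Delta>. 0 \<le> x \<bullet> \<alpha>)"

lemma dominant_positive:
  assumes "dominant x" "\<beta> \<in> Pos" shows "0 \<le> x \<bullet> \<beta>"
proof -
  have "0 \<le> \<beta> \<bullet> x" unfolding inner_simple_expansion[of \<beta> x]
    using assms positive_coeff_ge_0
    by (intro sum_nonneg mult_nonneg_nonneg) (auto simp: dominant_def inner_commute)
  then show ?thesis by (simp add: inner_commute)
qed

text \<open>The base alcove lies in the antidominant chamber. Since \<open>w p0\<close> is in the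
  dominant one, \<open>w\<close> and its inverse turn every positive root negative.\<close>

lemma image_alcove_opposite:
  assumes w: "w \<in> W" and neg: "\<And>\<alpha>. \<alpha> \<in> \<Delta> \<Longrightarrow> w p0 \<bullet> \<alpha> > 0"
  shows "w ` A0 = uminus ` A0"
proof -
  have wi: "inv_into UNIV w \<in> W" using W_inverse(2)[OF w] .
  have inv_neg: "- inv_into UNIV w \<beta> \<in> Pos" if b: "\<beta> \<in> Pos" for \<beta>
  proof -
    have "dominant (w p0)" unfolding dominant_def using neg by force
    then have "0 \<le> p0 \<bullet> inv_into UNIV w \<beta>"
      using dominant_positive[OF _ b] W_inner_left[OF w] by metis
    then have "inv_into UNIV w \<beta> \<notin> Pos" using alcove_pos[OF p0] by force
    then show ?thesis using root_cases W_root[OF wi positive_root[OF b]] by blast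
  qed
  have w_neg: "- w \<beta> \<in> Pos" if b: "\<beta> \<in> Pos" for \<beta>
  proof -
    have "w \<beta> \<notin> Pos"
      using inv_neg[of "w \<beta>"] W_inverse(4)[OF w] not_positive_and_negative[OF b] by auto
    then show ?thesis using root_cases W_root[OF w positive_root[OF b]] by blast
  qed
  show ?thesis
  proof
    show "w ` A0 \<subseteq> uminus ` A0"
    proof
      fix y assume "y \<in> w ` A0"
      then obtain q where q: "q \<in> A0" "y = w q" by blast
      have "- y \<in> A0" unfolding fundamental_alcove_def
        using alcove_pos[OF q(1) inv_neg] q(2) W_inner_left[OF w] by auto
      then show "y \<in> uminus ` A0" by force
    qed
    show "uminus ` A0 \<subseteq> w ` A0"
    proof
      fix y assume "y \<in> uminus ` A0"
      then obtain q where q: "q \<in> A0" "y = - q" by blast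
      have e: "inv_into UNIV w y \<bullet> \<beta> = q \<bullet> (- w \<beta>)" for \<beta>
        using W_inner[OF w, of "inv_into UNIV w y" \<beta>] W_inverse(3)[OF w] q(2) by simp
      have "- 1 < inv_into UNIV w y \<bullet> \<beta> \<and> inv_into UNIV w y \<bullet> \<beta> < 0" if "\<beta> \<in> Pos" for \<beta>
        unfolding e using alcove_pos[OF q(1) w_neg[OF that]] .
      then have "inv_into UNIV w y \<in> A0" by (simp add: fundamental_alcove_def)
      then show "y \<in> w ` A0" using W_inverse(3)[OF w] by (metis imageI)
    qed
  qed
qed

text \<open>At maximal length no simple reflection can lengthen further, so \<open>p0\<close> lands
  in the dominant chamber. Two such elements have the same image alcove and agree by regularity,
  which makes the definite description meaningful.\<close>

lemma longest_element:
  "longest_element \<Delta> \<in> W" "longest_element \<Delta> ` A0 = uminus ` A0"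
proof -
  let ?S = "simple_reflections \<Delta>"
  let ?P = "is_arg_max (word_length ?S) (\<lambda>w. w \<in> W)"
  have opp: "w \<in> W \<and> w ` A0 = uminus ` A0" if p: "?P w" for w
  proof -
    have w: "w \<in> W" using p unfolding is_arg_max_def by blast
    have "w p0 \<bullet> \<alpha> > 0" if a: "\<alpha> \<in> \<Delta>" for \<alpha>
    proof (rule ccontr)
      assume "\<not> w p0 \<bullet> \<alpha> > 0"
      moreover have "w p0 \<bullet> \<alpha> \<noteq> 0"
        using Wa_base_not_Ints[OF W_subset_Wa[OF w] simple_root[OF a]] by (metis Ints_0)
      ultimately have "w p0 \<bullet> \<alpha> < 0" by linarith
      moreover have s: "\<sigma> \<alpha> 0 \<circ> w \<in> W" using W_comp[OF W_simple[OF a] w] .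
      ultimately have "word_length ?S w < word_length ?S (\<sigma> \<alpha> 0 \<circ> w)"
        using length_less_reflected[OF simple_wall_reflections, of w \<alpha> 0] w wall_simple[OF a]
        unfolding W_eq_words wall_def by blast
      then show False using p s unfolding is_arg_max_def by blast
    qed
    then show ?thesis using image_alcove_opposite[OF w] w by blast
  qed
  have "\<exists>w. ?P w"
    using finite_is_arg_max[of W "word_length ?S"] W_finite W_id by blast
  moreover have "w = u" if "?P w" "?P u" for w u
  proof -
    have w: "w \<in> W" and u: "u \<in> W" and eq: "u ` A0 = w ` A0" using opp that by metis+
    have "u p0 \<in> w ` A0" using eq p0 by blast
    then have "(inv_into UNIV w \<circ> u) p0 \<in> A0" using W_inverse(4)[OF w] by auto
    then have "inv_into UNIV w \<circ> u = id" using W_regular W_comp W_inverse(2) w u by blast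
    then have "w (inv_into UNIV w (u x)) = w x" for x by (metis comp_apply id_apply)
    then show "w = u" using W_inverse(3)[OF w] by (auto simp: fun_eq_iff)
  qed
  ultimately have "\<exists>!w. ?P w" by blast
  from theI'[OF this] have "?P (longest_element \<Delta>)" unfolding longest_element_def .
  from opp[OF this] show "longest_element \<Delta> \<in> W" "longest_element \<Delta> ` A0 = uminus ` A0" by auto
qed

text \<open>The basis dual to the simple coroots; products with it are coefficients with respect to
  the simple coroots.\<close>

definition fundamental_weight :: "'a \<Rightarrow> 'a" ("\<varpi>") where
  "\<varpi> \<alpha> = ((\<alpha> \<bullet> \<alpha>) / 2) *\<^sub>R \<omega> \<alpha>"

lemma coroot_fundamental_weight:
  assumes "\<alpha> \<in> \<Delta>" shows "coroot \<alpha> \<bullet> \<varpi> \<gamma> = (if \<gamma> = \<alpha> then 1 else 0)"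
  using fundamental_coweight_inner[OF assms, of \<gamma>] root_nonzero[OF simple_root[OF assms]]
  by (auto simp: fundamental_weight_def coroot_def inner_commute)

lemma inner_coroot_expansion: "x \<bullet> y = (\<Sum>\<alpha>\<in>\<Delta>. (x \<bullet> \<varpi> \<alpha>) * (coroot \<alpha> \<bullet> y))"
  unfolding inner_simple_expansion[of x y]
  by (intro sum.cong) (auto simp: fundamental_weight_def coroot_def simple_root root_nonzero)

text \<open>Peel off the first letter of a shortest word,
  \<open>f = \<sigma> \<alpha> 0 \<circ> u\<close>. The inverse of \<open>u\<close> sends \<alpha>
  to a positive root, so the last reflection subtracts a nonnegative multiple of
  \<open>coroot \<alpha>\<close> from \<open>u x\<close>.\<close>

lemma dominant_diff_orbit:
  assumes "dominant x" "f \<in> W" "\<gamma> \<in> \<Delta>"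
  shows "0 \<le> (x - f x) \<bullet> \<varpi> \<gamma>"
  using assms(2)
proof (induction "word_length (simple_reflections \<Delta>) f" arbitrary: f rule: less_induct)
  case less
  let ?S = "simple_reflections \<Delta>"
  obtain ss where ss: "set ss \<subseteq> ?S" "length ss = word_length ?S f" "word_prod ss = f"
    using word_length_attained less.prems W_eq_words by metis
  show ?case
  proof (cases ss)
    case Nil
    then show ?thesis using ss(3) word_prod_Nil by (metis diff_self id_apply inner_zero_left order_refl)
  next
    case (Cons s ys)
    define u where "u = word_prod ys"
    obtain \<alpha> where a: "\<alpha> \<in> \<Delta>" "s = \<sigma> \<alpha> 0" using ss(1) Cons simple_reflections_iff by auto
    have f: "f = \<sigma> \<alpha> 0 \<circ> u" using ss(3) Cons a(2) word_prod_Cons u_def by metis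
    have uW: "u \<in> W" unfolding u_def W_eq_words words_def using ss(1) Cons by auto
    have len: "word_length ?S u < word_length ?S f"
      using word_length_le[of ys ?S] ss(1,2) Cons u_def by simp
    \<comment> \<open>Otherwise the hyperplane of \<alpha> separates \<open>u p0\<close> from
      \<open>p0\<close>, and \<open>f\<close> would be shorter than \<open>u\<close>.\<close>
    have "u p0 \<bullet> \<alpha> < 0"
    proof (rule ccontr)
      assume "\<not> u p0 \<bullet> \<alpha> < 0"
      moreover have "u p0 \<bullet> \<alpha> \<noteq> 0"
        using Wa_base_not_Ints[OF W_subset_Wa[OF uW] simple_root[OF a(1)]] by (metis Ints_0)
      ultimately have "0 < u p0 \<bullet> \<alpha>" by linarith
      then have "word_length ?S (\<sigma> \<alpha> 0 \<circ> u) < word_length ?S u"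
        using exchange_length[OF simple_wall_reflections, of u \<alpha> 0] uW wall_simple[OF a(1)]
        unfolding W_eq_words wall_def by blast
      then show False using len f by simp
    qed
    then have "inv_into UNIV u \<alpha> \<in> Pos"
      using W_inner_left[OF uW] root_cases W_root[OF W_inverse(2)[OF uW] simple_root[OF a(1)]]
        alcove_pos[OF p0] by (metis inner_minus_right neg_less_0_iff_less order_less_asym)
    then have "0 \<le> u x \<bullet> \<alpha>"
      using dominant_positive[OF assms(1)] W_inner_left[OF uW] by metis
    moreover have "(x - f x) \<bullet> \<varpi> \<gamma> = (x - u x) \<bullet> \<varpi> \<gamma> + (u x \<bullet> \<alpha>) * (if \<gamma> = \<alpha> then 1 else 0)"
      unfolding f using coroot_fundamental_weight[OF a(1), of \<gamma>]
      by (simp add: hyperplane_reflection_def inner_diff_left)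
    ultimately show ?thesis using less.hyps[OF len uW] by simp
  qed
qed

lemma dominant_inner_orbit_le:
  assumes "dominant x" "dominant y" "f \<in> W"
  shows "f x \<bullet> y \<le> x \<bullet> y"
proof -
  have "0 \<le> coroot \<alpha> \<bullet> y" if "\<alpha> \<in> \<Delta>" for \<alpha>
    using assms(2) that unfolding dominant_def coroot_def by (simp add: inner_commute)
  then have "0 \<le> (x - f x) \<bullet> y"
    unfolding inner_coroot_expansion[of "x - f x" y]
    using dominant_diff_orbit[OF assms(1,3)] by (intro sum_nonneg mult_nonneg_nonneg) auto
  then show ?thesis by (simp add: inner_diff_left)
qed


section \<open>The highest root\<close>

text \<open>The roots orthogonal to the whole orbit of \<delta> are orthogonal to all remaining
  roots, so irreducibility makes one of the two classes empty. But \<delta> itself is not orthogonal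
  to its orbit.\<close>

lemma orbit_not_orthogonal:
  assumes "\<beta> \<in> \<Phi>" "\<delta> \<in> \<Phi>"
  shows "\<exists>f\<in>W. \<beta> \<bullet> f \<delta> \<noteq> 0"
proof (rule ccontr)
  assume not: "\<not> ?thesis"
  define B where "B = {\<gamma> \<in> \<Phi>. \<forall>f\<in>W. \<gamma> \<bullet> f \<delta> = 0}"
  have "\<gamma> \<bullet> \<epsilon> = 0" if g: "\<gamma> \<in> \<Phi> - B" and e: "\<epsilon> \<in> B" for \<gamma> \<epsilon>
  proof -
    obtain f where f: "f \<in> W" "\<gamma> \<bullet> f \<delta> \<noteq> 0" using g unfolding B_def by blast
    have gr: "\<gamma> \<in> \<Phi>" using g by blast
    have "\<epsilon> \<bullet> (\<sigma> \<gamma> 0 \<circ> f) \<delta> = 0" "\<epsilon> \<bullet> f \<delta> = 0"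
      using e W_comp[OF W_reflection[OF gr] f(1)] f(1) unfolding B_def by blast+
    \<comment> \<open>Both products with \<open>\<epsilon>\<close> vanish, so the correction term of
      the reflection does too, and its first factor is nonzero by the choice of
      \<open>f\<close>.\<close>
    then have "(f \<delta> \<bullet> \<gamma>) * (\<epsilon> \<bullet> coroot \<gamma>) = 0"
      by (simp add: hyperplane_reflection_def inner_diff_right)
    then show ?thesis using f(2) root_nonzero[OF gr] by (auto simp: coroot_def inner_commute)
  qed
  moreover have "\<Phi> = (\<Phi> - B) \<union> B" unfolding B_def by blast
  ultimately have "\<Phi> - B = {} \<or> B = {}" using irreducible[of "\<Phi> - B" B] by blast
  moreover have "\<beta> \<in> B" unfolding B_def using not assms(1) by blast
  moreover have "\<delta> \<notin> B" unfolding B_def using W_id root_nonzero[OF assms(2)] by force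
  ultimately show False using assms(2) by blast
qed

lemma dominant_root_positive:
  assumes "dominant \<beta>" "\<beta> \<in> \<Phi>" shows "\<beta> \<in> Pos"
proof (rule ccontr)
  assume "\<beta> \<notin> Pos"
  then have "0 \<le> \<beta> \<bullet> (- \<beta>)" using dominant_positive[OF assms(1)] root_cases[OF assms(2)] by blast
  then have "\<beta> \<bullet> \<beta> = 0" using inner_ge_zero[of \<beta>] by simp
  then show False using root_nonzero[OF assms(2)] by simp
qed

text \<open>Dominance bounds the product of \<beta> with any element of the orbit of \<delta> by
  \<open>\<delta> \<bullet> \<beta>\<close>. The orbit is closed under negation, so if this bound
  were nonpositive all these products would vanish.\<close>

lemma dominant_roots_inner_pos:
  assumes "dominant \<beta>" "\<beta> \<in> \<Phi>" "dominant \<delta>" "\<delta> \<in> \<Phi>"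
  shows "0 < \<beta> \<bullet> \<delta>"
proof (rule ccontr)
  assume "\<not> 0 < \<beta> \<bullet> \<delta>"
  then have le: "\<delta> \<bullet> \<beta> \<le> 0" by (simp add: inner_commute)
  obtain f where f: "f \<in> W" "\<beta> \<bullet> f \<delta> \<noteq> 0" using orbit_not_orthogonal[OF assms(2,4)] by blast
  have "f \<delta> \<bullet> \<beta> \<le> 0" using dominant_inner_orbit_le[OF assms(3,1) f(1)] le by linarith
  moreover have "(f \<circ> \<sigma> \<delta> 0) \<delta> \<bullet> \<beta> \<le> 0"
    using dominant_inner_orbit_le[OF assms(3,1) W_comp[OF f(1) W_reflection[OF assms(4)]]] le by linarith
  then have "0 \<le> f \<delta> \<bullet> \<beta>" using reflection_self[OF assms(4)] W_minus[OF f(1)] by simp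
  ultimately show False using f(2) by (simp add: inner_commute)
qed

text \<open>If \<open>\<gamma> \<bullet> \<delta>\<close> is positive and less than
  \<open>\<delta> \<bullet> \<delta>\<close>, the Cartan integer lies strictly between 0 and 2, and
  reflecting in \<delta> subtracts \<delta> once. As \<alpha> - \<beta> has positive norm, this
  applies in one of the two orders.\<close>

lemma root_diff:
  assumes "\<alpha> \<in> \<Phi>" "\<beta> \<in> \<Phi>" "\<alpha> \<bullet> \<beta> > 0" "\<alpha> \<noteq> \<beta>"
  shows "\<alpha> - \<beta> \<in> \<Phi>"
proof -
  have diff: "\<gamma> - \<delta> \<in> \<Phi>" if "\<gamma> \<in> \<Phi>" "\<delta> \<in> \<Phi>" "\<gamma> \<bullet> \<delta> > 0" "\<gamma> \<bullet> \<delta> < \<delta> \<bullet> \<delta>" for \<gamma> \<delta>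
  proof -
    have "\<gamma> \<bullet> coroot \<delta> \<in> \<int>" using crystallographic that by blast
    moreover have "0 < \<delta> \<bullet> \<delta>" using root_nonzero[OF that(2)] by simp
    then have "0 < \<gamma> \<bullet> coroot \<delta>" "\<gamma> \<bullet> coroot \<delta> < 2"
      using that(3,4) by (auto simp: coroot_def divide_simps)
    ultimately have "\<gamma> \<bullet> coroot \<delta> = 1" using Ints_between_minus1_1[of "\<gamma> \<bullet> coroot \<delta> - 1"] by force
    then have "(\<gamma> \<bullet> \<delta>) * (2 / (\<delta> \<bullet> \<delta>)) = 1"
      unfolding coroot_def inner_scaleR_right by (simp only: mult.commute)
    moreover have "\<sigma> \<delta> 0 \<gamma> = \<gamma> - ((\<gamma> \<bullet> \<delta>) * (2 / (\<delta> \<bullet> \<delta>))) *\<^sub>R \<delta>"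
      by (simp add: hyperplane_reflection_def coroot_def)
    ultimately have "\<sigma> \<delta> 0 \<gamma> = \<gamma> - \<delta>" by (metis scaleR_one)
    then show ?thesis using reflection_root that by metis
  qed
  have "(\<alpha> - \<beta>) \<bullet> (\<alpha> - \<beta>) > 0" using assms(4) by simp
  then have "\<alpha> \<bullet> \<beta> < \<beta> \<bullet> \<beta> \<or> \<beta> \<bullet> \<alpha> < \<alpha> \<bullet> \<alpha>"
    by (auto simp: inner_diff_left inner_diff_right inner_commute)
  then show ?thesis
    using diff[of \<alpha> \<beta>] diff[of \<beta> \<alpha>] assms minus_root[of "\<beta> - \<alpha>"] by (auto simp: inner_commute)
qed

lemma nonneg_combinations_add:
  "\<lbrakk>x \<in> nonneg_combinations \<Delta>; y \<in> nonneg_combinations \<Delta>\<rbrakk> \<Longrightarrow> x + y \<in> nonneg_combinations \<Delta>"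
  by (simp add: nonneg_combinations_iff inner_add_left)

text \<open>A root of maximal height among those above \<open>\<gamma>\<close> is dominant.\<close>

lemma dominant_root_above:
  assumes "\<gamma> \<in> \<Phi>"
  obtains \<delta> where "\<delta> \<in> \<Phi>" "dominant \<delta>" "\<delta> - \<gamma> \<in> nonneg_combinations \<Delta>"
proof -
  define B where "B = {\<delta> \<in> \<Phi>. \<delta> - \<gamma> \<in> nonneg_combinations \<Delta>}"
  have "finite B" "B \<noteq> {}"
    unfolding B_def using finite_roots assms by (auto simp: nonneg_combinations_iff)
  then obtain \<delta> where d: "is_arg_max ht (\<lambda>\<delta>. \<delta> \<in> B) \<delta>" using finite_is_arg_max by blast
  then have dB: "\<delta> \<in> B" unfolding is_arg_max_def by blast
  then have dr: "\<delta> \<in> \<Phi>" unfolding B_def by blast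
  have "0 \<le> \<delta> \<bullet> \<alpha>" if a: "\<alpha> \<in> \<Delta>" for \<alpha>
  proof (rule ccontr)
    assume "\<not> 0 \<le> \<delta> \<bullet> \<alpha>"
    then have neg: "\<delta> \<bullet> coroot \<alpha> < 0"
      using root_nonzero[OF simple_root[OF a]] by (simp add: coroot_def divide_less_0_iff)
    \<comment> \<open>Reflecting in \<alpha> adds a natural multiple of \<alpha>, so the root stays
      above \<gamma> while its height grows.\<close>
    have "- (\<delta> \<bullet> coroot \<alpha>) \<in> \<nat>"
      using crystallographic[OF simple_root[OF a] dr] neg by (auto simp: Nats_altdef2)
    moreover have "(\<sigma> \<alpha> 0 \<delta> - \<gamma>) \<bullet> \<omega> \<epsilon>
        = (\<delta> - \<gamma>) \<bullet> \<omega> \<epsilon> + (if \<epsilon> = \<alpha> then - (\<delta> \<bullet> coroot \<alpha>) else 0)" if "\<epsilon> \<in> \<Delta>" for \<epsilon>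
      using simple_reflection_coeff[OF a that, of \<delta>] by (auto simp: inner_diff_left)
    ultimately have "\<sigma> \<alpha> 0 \<delta> - \<gamma> \<in> nonneg_combinations \<Delta>"
      using dB unfolding B_def nonneg_combinations_iff by auto
    then have "\<sigma> \<alpha> 0 \<delta> \<in> B" unfolding B_def using reflection_root[OF simple_root[OF a] dr] by blast
    moreover have "ht \<delta> < ht (\<sigma> \<alpha> 0 \<delta>)" using ht_simple_reflection[OF a] neg by simp
    ultimately show False using d unfolding is_arg_max_def by blast
  qed
  then show ?thesis using that dB unfolding dominant_def B_def by blast
qed

text \<open>Take a dominant root of maximal height. Its difference from any other dominant root is
  again a root, which cannot be negative by maximality. Every root lies below a dominant one, so
  this root is above all of them.\<close>

lemma highest_root:
  "highest_root \<Phi> \<Delta> \<in> \<Phi>" "\<beta> \<in> \<Phi> \<Longrightarrow> highest_root \<Phi> \<Delta> - \<beta> \<in> nonneg_combinations \<Delta>"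
proof -
  let ?P = "\<lambda>\<alpha>. \<alpha> \<in> \<Phi> \<and> (\<forall>\<beta>\<in>\<Phi>. \<alpha> - \<beta> \<in> nonneg_combinations \<Delta>)"
  define D where "D = {\<delta> \<in> \<Phi>. dominant \<delta>}"
  have "finite D" unfolding D_def using finite_roots by simp
  moreover obtain \<gamma> where "\<gamma> \<in> \<Phi>" using nonempty by blast
  then have "D \<noteq> {}" unfolding D_def using dominant_root_above by blast
  ultimately obtain \<theta> where t: "is_arg_max ht (\<lambda>\<delta>. \<delta> \<in> D) \<theta>" using finite_is_arg_max by blast
  then have tD: "\<theta> \<in> \<Phi>" "dominant \<theta>" unfolding is_arg_max_def D_def by blast+
  have "\<theta> - \<gamma> \<in> nonneg_combinations \<Delta>" if g: "\<gamma> \<in> \<Phi>" for \<gamma>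
  proof -
    obtain \<delta> where d: "\<delta> \<in> \<Phi>" "dominant \<delta>" "\<delta> - \<gamma> \<in> nonneg_combinations \<Delta>"
      using dominant_root_above[OF g] .
    show ?thesis
    proof (cases "\<theta> = \<delta>")
      case True
      then show ?thesis using d(3) by simp
    next
      case False
      have "\<theta> - \<delta> \<in> \<Phi>" using root_diff[OF tD(1) d(1) _ False] dominant_roots_inner_pos tD d by blast
      moreover have "- (\<theta> - \<delta>) \<notin> Pos"
      proof
        assume "- (\<theta> - \<delta>) \<in> Pos"
        then have "0 < ht (\<delta> - \<theta>)" using ht_positive by force
        then have "ht \<theta> < ht \<delta>" unfolding ht_def by (simp add: inner_diff_left sum_subtractf)
        then show False using t d unfolding is_arg_max_def D_def by blast
      qed
      ultimately have "\<theta> - \<delta> \<in> nonneg_combinations \<Delta>"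
        using root_cases unfolding positive_roots_def by blast
      from nonneg_combinations_add[OF this d(3)] show ?thesis by simp
    qed
  qed
  then have "?P \<theta>" using tD by blast
  moreover have "\<alpha> = \<beta>" if "?P \<alpha>" "?P \<beta>" for \<alpha> \<beta>
  proof -
    have "(\<alpha> - \<beta>) \<bullet> \<omega> \<gamma> = 0" if "\<gamma> \<in> \<Delta>" for \<gamma>
    proof -
      have "(\<alpha> - \<beta>) \<bullet> \<omega> \<gamma> \<in> \<nat>" "(\<beta> - \<alpha>) \<bullet> \<omega> \<gamma> \<in> \<nat>"
        using \<open>?P \<alpha>\<close> \<open>?P \<beta>\<close> \<open>\<gamma> \<in> \<Delta>\<close> unfolding nonneg_combinations_iff by blast+
      then show ?thesis by (auto simp: Nats_altdef2 inner_diff_left)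
    qed
    then show ?thesis using simple_expansion[of "\<alpha> - \<beta>"] by simp
  qed
  ultimately have "\<exists>!\<alpha>. ?P \<alpha>" by blast
  from theI'[OF this] have "?P (highest_root \<Phi> \<Delta>)" unfolding highest_root_def .
  then show "highest_root \<Phi> \<Delta> \<in> \<Phi>" "\<beta> \<in> \<Phi> \<Longrightarrow> highest_root \<Phi> \<Delta> - \<beta> \<in> nonneg_combinations \<Delta>"
    by blast+
qed

abbreviation hr where "hr \<equiv> highest_root \<Phi> \<Delta>"

lemma highest_root_coeff_ge: "\<lbrakk>\<beta> \<in> \<Phi>; \<alpha> \<in> \<Delta>\<rbrakk> \<Longrightarrow> \<beta> \<bullet> \<omega> \<alpha> \<le> hr \<bullet> \<omega> \<alpha>"
  using highest_root(2)[of \<beta>] by (auto simp: nonneg_combinations_iff Nats_altdef2 inner_diff_left)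

lemma highest_root_dominant: "dominant hr"
  unfolding dominant_def
proof
  fix \<alpha> assume a: "\<alpha> \<in> \<Delta>"
  have "\<sigma> \<alpha> 0 hr \<bullet> \<omega> \<alpha> \<le> hr \<bullet> \<omega> \<alpha>"
    using highest_root_coeff_ge[OF reflection_root[OF simple_root[OF a] highest_root(1)] a] .
  then have "0 \<le> hr \<bullet> coroot \<alpha>" using simple_reflection_coeff[OF a a, of hr] by simp
  moreover have "hr \<bullet> \<alpha> = (hr \<bullet> coroot \<alpha>) * ((\<alpha> \<bullet> \<alpha>) / 2)"
    using root_nonzero[OF simple_root[OF a]] by (simp add: coroot_def)
  moreover have "0 \<le> (\<alpha> \<bullet> \<alpha>) / 2" by simp
  ultimately show "0 \<le> hr \<bullet> \<alpha>" by (metis mult_nonneg_nonneg)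
qed

lemma highest_root_positive: "hr \<in> Pos"
  using dominant_root_positive highest_root_dominant highest_root(1) by blast

text \<open>For a pairing \<open>n\<close> of at least 2, \<open>n *\<^sub>R hr - \<beta>\<close> is
  a root too. Since neither it nor \<beta> exceeds \<open>hr\<close> in any coefficient, \<beta>
  equals \<open>hr\<close>.\<close>

lemma highest_root_pairing:
  assumes "\<beta> \<in> Pos" "\<beta> \<noteq> hr"
  shows "\<beta> \<bullet> coroot hr = 0 \<or> \<beta> \<bullet> coroot hr = 1"
proof -
  define n where "n = \<beta> \<bullet> coroot hr"
  have "n \<in> \<int>" unfolding n_def using crystallographic highest_root(1) positive_root[OF assms(1)] by blast
  moreover have "0 \<le> n"
    using dominant_positive[OF highest_root_dominant assms(1)] unfolding n_def coroot_def
    by (simp add: inner_commute)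
  moreover have "\<not> 2 \<le> n"
  proof
    assume n2: "2 \<le> n"
    have r: "- \<sigma> hr 0 \<beta> \<in> \<Phi>"
      using minus_root[OF reflection_root[OF highest_root(1) positive_root[OF assms(1)]]] .
    have e: "\<sigma> hr 0 \<beta> = \<beta> - n *\<^sub>R hr" unfolding n_def by (simp add: hyperplane_reflection_def coroot_def)
    have "(hr - \<beta>) \<bullet> \<omega> \<alpha> = 0" if a: "\<alpha> \<in> \<Delta>" for \<alpha>
    proof -
      have "n * (hr \<bullet> \<omega> \<alpha>) - \<beta> \<bullet> \<omega> \<alpha> \<le> hr \<bullet> \<omega> \<alpha>"
        using highest_root_coeff_ge[OF r a] e by (simp add: inner_diff_left)
      moreover have "2 * (hr \<bullet> \<omega> \<alpha>) \<le> n * (hr \<bullet> \<omega> \<alpha>)"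
        using n2 positive_coeff_ge_0[OF highest_root_positive a] by (rule mult_right_mono)
      moreover have "\<beta> \<bullet> \<omega> \<alpha> \<le> hr \<bullet> \<omega> \<alpha>" using highest_root_coeff_ge[OF positive_root[OF assms(1)] a] .
      ultimately show ?thesis by (simp add: inner_diff_left)
    qed
    then have "hr - \<beta> = 0" using simple_expansion[of "hr - \<beta>"] by simp
    then show False using assms(2) by simp
  qed
  ultimately have "n = 0 \<or> n = 1"
    using Ints_between_minus1_1[of n] Ints_between_minus1_1[of "n - 1"] by force
  then show ?thesis unfolding n_def .
qed

text \<open>With pairing 0 the value is unchanged. With pairing 1, \<open>hr - \<beta>\<close> is a
  positive root and the new value is -1 minus its value at \<open>p0\<close>, again between -1 and
  0.\<close>

lemma highest_root_reflection:
  assumes "\<beta> \<in> Pos" "\<beta> \<noteq> hr"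
  shows "\<sigma> hr (- 1) p0 \<bullet> \<beta> = p0 \<bullet> \<beta> \<or> (- 1 < \<sigma> hr (- 1) p0 \<bullet> \<beta> \<and> \<sigma> hr (- 1) p0 \<bullet> \<beta> < 0)"
proof -
  define n where "n = \<beta> \<bullet> coroot hr"
  have "\<sigma> hr 0 \<beta> = \<beta> - n *\<^sub>R hr" unfolding n_def by (simp add: hyperplane_reflection_def coroot_def)
  then have e: "\<sigma> hr (- 1) p0 \<bullet> \<beta> = p0 \<bullet> (\<beta> - n *\<^sub>R hr) - n"
    using hyperplane_reflection_inner[of hr "- 1" p0 \<beta> 0] unfolding n_def by (simp add: inner_commute)
  have "n = 0 \<or> n = 1" unfolding n_def using highest_root_pairing[OF assms] .
  then show ?thesis
  proof
    assume "n = 0"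
    then show ?thesis using e by simp
  next
    assume n: "n = 1"
    then have "\<beta> - hr \<in> \<Phi>"
      using \<open>\<sigma> hr 0 \<beta> = \<beta> - n *\<^sub>R hr\<close> reflection_root[OF highest_root(1) positive_root[OF assms(1)]] by simp
    then have "hr - \<beta> \<in> Pos"
      using minus_root[of "\<beta> - hr"] highest_root(2)[OF positive_root[OF assms(1)]]
      unfolding positive_roots_def by simp
    from alcove_pos[OF p0 this] show ?thesis using e n by (simp add: inner_diff_right)
  qed
qed

text \<open>The affine generator is described by \<open>(- hr, 1)\<close> because \<open>p0\<close>
  has to lie on the negative side. All roots other than \<open>hr\<close> and its negative keep
  their unit interval under this reflection.\<close>

lemma wall_highest_root: "wall (- hr) 1"
  unfolding wall_def
proof (intro conjI ballI impI)
  let ?s = "\<sigma> hr (- 1)"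
  have s: "\<sigma> (- hr) 1 = ?s" using hyperplane_reflection_minus[of hr "- 1"] by simp
  have hp: "- 1 < p0 \<bullet> hr" "p0 \<bullet> hr < 0" using alcove_pos[OF p0 highest_root_positive] by simp_all
  have sh: "?s p0 \<bullet> hr = - 2 - p0 \<bullet> hr"
    using hyperplane_reflection_inner_self[OF root_nonzero[OF highest_root(1)], of "- 1" p0] by simp
  show "- hr \<in> \<Phi>" using minus_root highest_root(1) by blast
  show "1 \<in> (\<int>::real set)" by simp
  show "p0 \<bullet> (- hr) < 1" using hp by simp
  fix \<gamma> k assume g: "\<gamma> \<in> \<Phi>" "k \<in> (\<int>::real set)" "p0 \<bullet> \<gamma> < k" "k < \<sigma> (- hr) 1 p0 \<bullet> \<gamma>"
  then have k: "k < ?s p0 \<bullet> \<gamma>" using s by simp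
  have "\<gamma> = - hr \<and> k = 1"
  proof (cases "\<gamma> = - hr")
    case True
    then have "0 < k" "k < 2" using k g(3) sh hp by simp_all
    then have "k = 1" using Ints_between_minus1_1[of "k - 1"] g(2) by force
    then show ?thesis using True by simp
  next
    case False
    have "\<gamma> \<noteq> hr" using k g(3) sh hp by force
    show ?thesis using root_cases[OF g(1)]
    proof
      assume p: "\<gamma> \<in> Pos"
      have "?s p0 \<bullet> \<gamma> < 0" "- 1 < p0 \<bullet> \<gamma>"
        using highest_root_reflection[OF p \<open>\<gamma> \<noteq> hr\<close>] alcove_pos[OF p0 p] by force+
      then show ?thesis using Ints_strictly_between[OF g(2), of "- 1"] k g(3) by force
    next
      assume p: "- \<gamma> \<in> Pos"
      moreover have "- \<gamma> \<noteq> hr" using False by (metis minus_minus)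
      ultimately have "?s p0 \<bullet> \<gamma> < 1" "0 < p0 \<bullet> \<gamma>"
        using highest_root_reflection[of "- \<gamma>"] alcove_pos[OF p0 p] by force+
      then show ?thesis using Ints_strictly_between[OF g(2), of 0] k g(3) by force
    qed
  qed
  then show "\<gamma> = - hr" "k = 1" by simp_all
qed


section \<open>The affine Weyl group as a Coxeter group\<close>

abbreviation Sa where "Sa \<equiv> affine_simple_reflections \<Phi> \<Delta>"

lemma Sa_iff: "s \<in> Sa \<longleftrightarrow> s = \<sigma> (- hr) 1 \<or> (\<exists>\<alpha>\<in>\<Delta>. s = \<sigma> \<alpha> 0)"
  unfolding affine_simple_reflections_def
  using hyperplane_reflection_minus[of hr "- 1"] by (auto simp: simple_reflections_iff)

lemma affine_wall_reflections: "wall_reflections Sa"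
  using wall_simple wall_highest_root Sa_iff unfolding wall_reflections_def by metis

lemma W_subset_words: "W \<subseteq> words Sa"
  unfolding W_eq_words affine_simple_reflections_def by (rule words_mono) blast

text \<open>Up to sign, \<open>coroot hr\<close> pairs to \<open>0\<close> or \<open>1\<close> with all roots other than \<open>\<plusminus>hr\<close>, so reflecting it in a root \<open>\<beta>\<close>
  not orthogonal to it changes it by exactly \<open>\<plusminus>coroot \<beta>\<close>: its orbit generates the coroot lattice.\<close>

lemma translation_in_words:
  assumes "x \<in> Q" shows "(+) x \<in> words Sa"
proof -
  define M where "M = {x. (+) x \<in> words Sa}"
  have add: "x + y \<in> M" if "x \<in> M" "y \<in> M" for x y
  proof -
    have "(+) x \<circ> (+) y = (+) (x + y)" by (auto simp: fun_eq_iff)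
    then show ?thesis using that words_comp unfolding M_def by fastforce
  qed
  have zero: "0 \<in> M"
  proof -
    have "(+) (0::'a) = id" by (auto simp: fun_eq_iff)
    then show ?thesis unfolding M_def using id_in_words by auto
  qed
  have inv: "s \<circ> s = id" if "s \<in> Sa" for s
    using that affine_wall_reflections reflection_comp_self unfolding wall_reflections_def wall_def by metis
  have neg: "- x \<in> M" if x: "x \<in> M" for x
  proof -
    have "(+) x \<in> words Sa" using x unfolding M_def by blast
    from words_inverse[of Sa, OF inv this] obtain g where
      g: "g \<in> words Sa" "(+) x \<circ> g = id" by blast
    have "g = (+) (- x)"
    proof
      fix v show "g v = - x + v" using fun_cong[OF g(2), of v] by (simp add: algebra_simps)
    qed
    then show ?thesis using g(1) unfolding M_def by simp
  qed
  have conj: "f x \<in> M" if "x \<in> M" "f \<in> W" for f x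
  proof -
    have "f \<circ> (+) x \<circ> inv_into UNIV f = (+) (f x)"
      using W_inverse(3)[OF that(2)] by (auto simp: fun_eq_iff W_add[OF that(2)])
    moreover have "f \<in> words Sa" "inv_into UNIV f \<in> words Sa"
      using that(2) W_inverse(2)[OF that(2)] W_subset_words by blast+
    ultimately show ?thesis using that(1) unfolding M_def by (metis mem_Collect_eq words_comp)
  qed
  have hrM: "coroot hr \<in> M"
  proof -
    \<comment> \<open>Reflections in two parallel hyperplanes compose to a translation across
      them.\<close>
    have "\<sigma> hr 0 \<circ> \<sigma> (- hr) 1 = (+) (coroot hr)"
    proof
      fix v
      have "\<sigma> (- hr) 1 v = - coroot hr + \<sigma> hr 0 v"
        using hyperplane_reflection_affine[of hr "- 1" v] hyperplane_reflection_minus[of hr "- 1"] by simp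
      moreover have "\<sigma> hr 0 (- coroot hr) = coroot hr"
        using W_coroot[OF W_reflection[OF highest_root(1)], of "- hr"]
          reflection_self[OF highest_root(1)] linear_neg[OF linear_reflection[of hr], of hr]
        by (simp add: coroot_minus)
      ultimately show "(\<sigma> hr 0 \<circ> \<sigma> (- hr) 1) v = coroot hr + v"
        using hyperplane_reflection_involution[OF root_nonzero[OF highest_root(1)], of 0 v]
        by (simp only: comp_apply linear_add[OF linear_reflection])
    qed
    moreover have "\<sigma> hr 0 \<in> words Sa" "\<sigma> (- hr) 1 \<in> words Sa"
      using W_subset_words W_reflection[OF highest_root(1)] generator_in_words[of _ Sa] Sa_iff by blast+
    ultimately show ?thesis unfolding M_def by (metis mem_Collect_eq words_comp)
  qed
  have cor: "coroot \<beta> \<in> M" if b: "\<beta> \<in> \<Phi>" for \<beta>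
  proof -
    \<comment> \<open>Irreducibility provides \<open>f\<close> with \<open>f hr\<close> not
      orthogonal to \<beta>; undoing \<open>f\<close> replaces \<beta> by a conjugate not orthogonal
      to \<open>hr\<close>.\<close>
    obtain f where f: "f \<in> W" "\<beta> \<bullet> f hr \<noteq> 0" using orbit_not_orthogonal[OF b highest_root(1)] by blast
    let ?g = "inv_into UNIV f"
    have g: "?g \<in> W" using W_inverse(2)[OF f(1)] .
    have gb: "?g \<beta> \<in> \<Phi>" using W_root[OF g b] .
    have fg: "f (?g \<beta>) = \<beta>" using W_inverse(3)[OF f(1)] .
    define n where "n = ?g \<beta> \<bullet> coroot hr"
    have "?g \<beta> \<bullet> hr \<noteq> 0" using f(2) W_inner[OF f(1), of "?g \<beta>" hr] fg by simp
    then have n0: "n \<noteq> 0" unfolding n_def using root_nonzero[OF highest_root(1)] by (simp add: coroot_def)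
    have "coroot (?g \<beta>) \<in> M"
    proof (cases "?g \<beta> = hr \<or> ?g \<beta> = - hr")
      case True
      then show ?thesis using hrM neg[OF hrM] by (auto simp: coroot_minus)
    next
      case False
      then have ne: "?g \<beta> \<noteq> hr" "- ?g \<beta> \<noteq> hr" by (metis, metis minus_minus)
      have "n = 1 \<or> n = - 1" using root_cases[OF gb]
      proof
        assume "?g \<beta> \<in> Pos"
        from highest_root_pairing[OF this ne(1)] show ?thesis using n0 unfolding n_def by simp
      next
        assume "- ?g \<beta> \<in> Pos"
        from highest_root_pairing[OF this ne(2)] show ?thesis using n0 unfolding n_def by auto
      qed
      define k where "k = coroot hr \<bullet> ?g \<beta>"
      have "k = n" unfolding k_def n_def by (simp add: inner_commute)
      then have "k = 1 \<or> k = - 1" using \<open>n = 1 \<or> n = - 1\<close> by simp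
      moreover have "\<sigma> (?g \<beta>) 0 (coroot hr) = coroot hr - k *\<^sub>R coroot (?g \<beta>)"
        unfolding k_def by (simp add: hyperplane_reflection_def)
      then have "k *\<^sub>R coroot (?g \<beta>) = coroot hr + - \<sigma> (?g \<beta>) 0 (coroot hr)" by simp
      then have "k *\<^sub>R coroot (?g \<beta>) \<in> M"
        using add[OF hrM neg[OF conj[OF hrM W_reflection[OF gb]]]] by simp
      ultimately show ?thesis using neg[of "- coroot (?g \<beta>)"] by auto
    qed
    from conj[OF this f(1)] show ?thesis using W_coroot[OF f(1)] fg by simp
  qed
  have scale: "of_int c *\<^sub>R coroot \<beta> \<in> M" if b: "\<beta> \<in> \<Phi>" for \<beta> c
  proof -
    have nat: "real n *\<^sub>R coroot \<beta> \<in> M" for n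
      by (induction n) (use zero add[OF cor[OF b]] in \<open>auto simp: scaleR_left_distrib\<close>)
    show ?thesis
    proof (cases c)
      case (nonneg n)
      then show ?thesis using nat[of n] by simp
    next
      case (neg n)
      then have "real_of_int c = - real (Suc n)" by simp
      then show ?thesis
        using \<open>\<And>x. x \<in> M \<Longrightarrow> - x \<in> M\<close>[OF nat[of "Suc n"]] by (simp only: scaleR_minus_left)
    qed
  qed
  have "x \<in> M" using assms by (induction rule: Q_induct) (use zero add scale in auto)
  then show ?thesis unfolding M_def by blast
qed

lemma Wa_eq_words: "Wa = words Sa"
proof
  show "words Sa \<subseteq> Wa" using wall_reflections_Wa[OF affine_wall_reflections] by blast
  show "Wa \<subseteq> words Sa"
  proof
    fix g assume "g \<in> Wa"
    then obtain x f where xf: "x \<in> Q" "f \<in> W" "g = (\<lambda>v. x + f v)" unfolding Wa_iff by blast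
    then have "g = (+) x \<circ> f" by (auto simp: fun_eq_iff)
    then show "g \<in> words Sa"
      using words_comp translation_in_words[OF xf(1)] W_subset_words xf(2) by blast
  qed
qed

lemma Wa_regular: "\<lbrakk>g \<in> Wa; g p0 \<in> A0\<rbrakk> \<Longrightarrow> g = id"
  using words_regular[OF affine_wall_reflections] Wa_eq_words by blast

lemma reflection_orientation:
  assumes "\<alpha> \<in> \<Phi>" "k \<in> \<int>"
  obtains \<beta> m where "\<beta> \<in> \<Phi>" "m \<in> \<int>" "p0 \<bullet> \<beta> < m" "\<sigma> \<alpha> k = \<sigma> \<beta> m"
proof (cases "p0 \<bullet> \<alpha> < k")
  case True
  then show ?thesis using that assms by blast
next
  case False
  moreover have "p0 \<bullet> \<alpha> \<noteq> k" using Wa_base_not_Ints[OF Wa_id assms(1)] assms(2) by auto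
  ultimately have "p0 \<bullet> (- \<alpha>) < - k" by simp
  then show ?thesis
    using that[of "- \<alpha>" "- k"] minus_root[OF assms(1)] assms(2) hyperplane_reflection_minus[of \<alpha> k] by simp
qed

text \<open>The hyperplane of a reflection separates \<open>p0\<close> from its mirror image, so
  \<open>exchange\<close>, applied to a word for the reflection itself, exhibits it as a conjugate
  of a letter.\<close>

lemma reflection_in_coxeter_reflections:
  assumes "\<alpha> \<in> \<Phi>" "k \<in> \<int>"
  shows "\<sigma> \<alpha> k \<in> coxeter_reflections Wa Sa"
proof -
  obtain \<beta> m where b: "\<beta> \<in> \<Phi>" "m \<in> \<int>" "p0 \<bullet> \<beta> < m" "\<sigma> \<alpha> k = \<sigma> \<beta> m"
    using reflection_orientation[OF assms] .
  obtain ss where ss: "set ss \<subseteq> Sa" "\<sigma> \<beta> m = word_prod ss"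
    using Wa_reflection[OF b(1,2)] unfolding Wa_eq_words words_def by blast
  have "m < word_prod ss p0 \<bullet> \<beta>"
    using hyperplane_reflection_inner_self[OF root_nonzero[OF b(1)], of m p0] b(3) ss(2) by simp
  from exchange[OF affine_wall_reflections ss(1) b(1-3) this]
  obtain xs s ys where x: "ss = xs @ s # ys" "\<sigma> \<beta> m \<circ> word_prod xs = word_prod xs \<circ> s" by blast
  define w where "w = word_prod xs"
  have w: "w \<in> Wa" unfolding w_def Wa_eq_words words_def using ss(1) x(1) by auto
  have "\<sigma> \<beta> m v = (w \<circ> s \<circ> inv_into UNIV w) v" for v
    using fun_cong[OF x(2), of "inv_into UNIV w v"] Wa_inverse(3)[OF w] unfolding w_def by simp
  then have "\<sigma> \<beta> m = w \<circ> s \<circ> inv_into UNIV w" by blast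
  moreover have "s \<in> Sa" using ss(1) x(1) by simp
  ultimately have "\<sigma> \<alpha> k = w \<circ> s \<circ> inv_into UNIV w \<and> w \<in> Wa \<and> s \<in> Sa" using w b(4) by metis
  then show ?thesis unfolding coxeter_reflections_def by (intro CollectI exI)
qed

text \<open>Turns right multiplication, as in the definition of the Bruhat order, into left
  multiplication by a reflection in an oriented hyperplane, as in
  \<open>exchange_length\<close>.\<close>

lemma coxeter_reflection_hyperplane:
  assumes "t \<in> coxeter_reflections Wa Sa" "u \<in> Wa"
  obtains \<alpha> k where "\<alpha> \<in> \<Phi>" "k \<in> \<int>" "p0 \<bullet> \<alpha> < k" "u \<circ> t = \<sigma> \<alpha> k \<circ> u"
proof -
  obtain w s where w: "w \<in> Wa" "s \<in> Sa" "t = w \<circ> s \<circ> inv_into UNIV w"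
    using assms(1) unfolding coxeter_reflections_def by blast
  obtain \<beta> m where b: "wall \<beta> m" "s = \<sigma> \<beta> m"
    using w(2) affine_wall_reflections unfolding wall_reflections_def by blast
  have b': "\<beta> \<in> \<Phi>" "m \<in> \<int>" using b(1) unfolding wall_def by blast+
  obtain \<gamma> j where g: "\<gamma> \<in> \<Phi>" "j \<in> \<int>" "(u \<circ> w) \<circ> \<sigma> \<beta> m = \<sigma> \<gamma> j \<circ> (u \<circ> w)"
    using Wa_push_forward[OF Wa_comp[OF assms(2) w(1)] b'] .
  obtain \<alpha> k where a: "\<alpha> \<in> \<Phi>" "k \<in> \<int>" "p0 \<bullet> \<alpha> < k" "\<sigma> \<gamma> j = \<sigma> \<alpha> k"
    using reflection_orientation[OF g(1,2)] .
  have "(u \<circ> t) v = (\<sigma> \<alpha> k \<circ> u) v" for v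
    using fun_cong[OF g(3), of "inv_into UNIV w v"] a(4) Wa_inverse(3)[OF w(1)] w(3) b(2) by simp
  then have "u \<circ> t = \<sigma> \<alpha> k \<circ> u" by blast
  then show ?thesis using that a by blast
qed

section \<open>Separating hyperplanes and transitivity on alcoves\<close>

definition separating :: "'a \<Rightarrow> ('a \<times> real) set" where
  "separating q = {(\<alpha>, k). \<alpha> \<in> \<Phi> \<and> k \<in> \<int> \<and> p0 \<bullet> \<alpha> < k \<and> k < q \<bullet> \<alpha>}"

lemma finite_separating: "finite (separating q)"
proof -
  have "separating q \<subseteq> (\<Union>\<alpha>\<in>\<Phi>. (\<lambda>k. (\<alpha>, k)) ` {k \<in> \<int>. p0 \<bullet> \<alpha> \<le> k \<and> k \<le> q \<bullet> \<alpha>})"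
    unfolding separating_def by force
  moreover have "finite \<dots>" using finite_roots finite_int_segment by blast
  ultimately show ?thesis using finite_subset by blast
qed

text \<open>Pulling back along the reflection, which is the map \<open>T\<close>, injects the
  hyperplanes separating \<open>p0\<close> from the reflected point into those separating it from
  \<open>q\<close>. The wall itself is missed.\<close>

lemma separating_wall_reflection:
  assumes "wall \<beta> m" "m < q \<bullet> \<beta>"
  shows "card (separating (\<sigma> \<beta> m q)) < card (separating q)"
proof -
  define T where "T = (\<lambda>(\<alpha>, k). (\<sigma> \<beta> 0 \<alpha>, k - m * (coroot \<beta> \<bullet> \<alpha>)))"
  have b: "\<beta> \<in> \<Phi>" "m \<in> \<int>" "p0 \<bullet> \<beta> < m" using assms(1) unfolding wall_def by blast+
  have inner: "\<sigma> \<beta> m v \<bullet> \<alpha> - k = v \<bullet> fst (T (\<alpha>, k)) - snd (T (\<alpha>, k))" for v \<alpha> k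
    unfolding T_def by (simp add: hyperplane_reflection_inner)
  have inv: "T (T x) = x" for x
  proof -
    obtain \<alpha> k where x: "x = (\<alpha>, k)" by fastforce
    have "coroot \<beta> \<bullet> \<sigma> \<beta> 0 \<alpha> = - (coroot \<beta> \<bullet> \<alpha>)"
      using inner_coroot_self[OF root_nonzero[OF b(1)]]
      by (simp add: hyperplane_reflection_def inner_diff_right coroot_def inner_commute)
    then show ?thesis unfolding x T_def
      by (simp add: hyperplane_reflection_involution root_nonzero b)
  qed
  have "T ` separating (\<sigma> \<beta> m q) \<subseteq> separating q - {(\<beta>, m)}"
  proof
    fix x assume "x \<in> T ` separating (\<sigma> \<beta> m q)"
    then obtain \<alpha> k where x: "x = T (\<alpha>, k)" and a: "\<alpha> \<in> \<Phi>" "k \<in> \<int>" "p0 \<bullet> \<alpha> < k" "k < \<sigma> \<beta> m q \<bullet> \<alpha>"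
      unfolding separating_def by blast
    \<comment> \<open>Only the wall separates \<open>p0\<close> from its mirror image. Any other
      hyperplane keeps \<open>p0\<close> on its negative side when pulled back.\<close>
    have "\<not> k < \<sigma> \<beta> m p0 \<bullet> \<alpha>"
    proof
      assume "k < \<sigma> \<beta> m p0 \<bullet> \<alpha>"
      then have "\<alpha> = \<beta>" "k = m" using assms(1) a unfolding wall_def by blast+
      then show False
        using a(4) assms(2) hyperplane_reflection_inner_self[OF root_nonzero[OF b(1)], of m q] by simp
    qed
    moreover have "\<sigma> \<beta> m p0 \<bullet> \<alpha> \<noteq> k"
      using Wa_base_not_Ints[OF Wa_reflection[OF b(1,2)] a(1)] a(2) by blast
    ultimately have "p0 \<bullet> fst x < snd x" using inner[of p0 \<alpha> k] x by simp
    moreover have "snd x < q \<bullet> fst x" using inner[of q \<alpha> k] a(4) x by simp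
    moreover have "fst x \<in> \<Phi>" using x a(1) b(1) by (simp add: T_def reflection_root)
    moreover have "coroot \<beta> \<bullet> \<alpha> \<in> \<int>" using crystallographic[OF b(1) a(1)] by (simp add: inner_commute)
    then have "snd x \<in> \<int>" using x a(2) b(2) by (simp add: T_def)
    ultimately have "x \<in> separating q" unfolding separating_def by (simp add: case_prod_unfold)
    moreover have "x \<noteq> (\<beta>, m)"
    proof
      assume "x = (\<beta>, m)"
      then have "(\<alpha>, k) = T (\<beta>, m)" using x inv by metis
      then have "\<alpha> = - \<beta>" "k = - m"
        using reflection_self[OF b(1)] inner_coroot_self[OF root_nonzero[OF b(1)]]
        by (auto simp: T_def inner_commute)
      then show False using a(3) b(3) by simp
    qed
    ultimately show "x \<in> separating q - {(\<beta>, m)}" by blast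
  qed
  then have "card (T ` separating (\<sigma> \<beta> m q)) \<le> card (separating q - {(\<beta>, m)})"
    using card_mono[OF finite_Diff[OF finite_separating]] by blast
  moreover have "inj T" using inv by (metis injI)
  then have "card (T ` separating (\<sigma> \<beta> m q)) = card (separating (\<sigma> \<beta> m q))"
    by (meson card_image inj_on_subset subset_UNIV)
  moreover have "(\<beta>, m) \<in> separating q" unfolding separating_def using b assms(2) by blast
  then have "card (separating q - {(\<beta>, m)}) < card (separating q)"
    using finite_separating by (meson card_Diff1_less)
  ultimately show ?thesis by linarith
qed

text \<open>Induction on the number of separating hyperplanes, which drops on reflecting in a wall
  that \<open>q\<close> lies beyond. If there is none, the simple walls make \<open>- q\<close>
  dominant and the highest root bounds the other positive roots from below.\<close>

lemma alcove_transitive: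
  assumes "\<And>\<beta>. \<beta> \<in> \<Phi> \<Longrightarrow> q \<bullet> \<beta> \<notin> \<int>"
  shows "\<exists>w\<in>Wa. w q \<in> A0"
  using assms
proof (induction "card (separating q)" arbitrary: q rule: less_induct)
  case less
  show ?case
  proof (cases "q \<in> A0")
    case True
    then show ?thesis using Wa_id by (metis id_apply)
  next
    case False
    have "\<exists>\<beta> m. wall \<beta> m \<and> m < q \<bullet> \<beta>"
    proof (rule ccontr)
      assume "\<not> ?thesis"
      then have "q \<bullet> \<beta> \<le> m" if "wall \<beta> m" for \<beta> m using that by force
      then have le: "q \<bullet> \<alpha> \<le> 0" "q \<bullet> (- hr) \<le> 1" if "\<alpha> \<in> \<Delta>" for \<alpha>
        using wall_simple[OF that] wall_highest_root by blast+
      have "- 1 < q \<bullet> \<beta> \<and> q \<bullet> \<beta> < 0" if b: "\<beta> \<in> Pos" for \<beta>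
      proof
        have dom: "dominant (- q)" unfolding dominant_def using le by simp
        \<comment> \<open>Both bounds in \<open>le\<close> are stated for a given simple root, so
          one is produced to access the bound on \<open>hr\<close>.\<close>
        obtain \<alpha> where a: "\<alpha> \<in> \<Delta>"
          using b simple_expansion[of \<beta>] positive_root root_nonzero by fastforce
        show "q \<bullet> \<beta> < 0"
          using dominant_positive[OF dom b] less.prems[OF positive_root[OF b]]
          by (metis Ints_0 inner_minus_left neg_0_le_iff_le order_le_less)
        have "0 \<le> (hr - \<beta>) \<bullet> (- q)"
          unfolding inner_simple_expansion[of "hr - \<beta>" "- q"]
        proof (intro sum_nonneg mult_nonneg_nonneg)
          fix \<gamma> assume g: "\<gamma> \<in> \<Delta>"
          show "0 \<le> (hr - \<beta>) \<bullet> \<omega> \<gamma>"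
            using highest_root_coeff_ge[OF positive_root[OF b] g] by (simp add: inner_diff_left)
          show "0 \<le> \<gamma> \<bullet> (- q)" using dom g unfolding dominant_def inner_commute[of \<gamma>] by blast
        qed
        then have "q \<bullet> hr \<le> q \<bullet> \<beta>" by (simp add: inner_diff_left inner_commute[of q])
        moreover have "- 1 \<le> q \<bullet> hr" using le(2)[OF a] by simp
        moreover have "q \<bullet> hr \<noteq> - 1" using less.prems[OF highest_root(1)] by (metis Ints_1 Ints_minus)
        ultimately show "- 1 < q \<bullet> \<beta>" by linarith
      qed
      then show False using False unfolding fundamental_alcove_def by blast
    qed
    then obtain \<beta> m where w: "wall \<beta> m" "m < q \<bullet> \<beta>" by blast
    then have sW: "\<sigma> \<beta> m \<in> Wa" unfolding wall_def using Wa_reflection by blast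
    have "\<sigma> \<beta> m q \<bullet> \<gamma> \<notin> \<int>" if g: "\<gamma> \<in> \<Phi>" for \<gamma>
    proof
      assume i: "\<sigma> \<beta> m q \<bullet> \<gamma> \<in> \<int>"
      obtain \<delta> j where "\<delta> \<in> \<Phi>" "j \<in> \<int>" "\<And>v. \<sigma> \<beta> m v \<bullet> \<gamma> - 0 = v \<bullet> \<delta> - j"
        using Wa_pull_back[OF sW g Ints_0] by metis
      then show False using less.prems i by (metis Ints_add diff_add_cancel diff_zero)
    qed
    then obtain u where "u \<in> Wa" "u (\<sigma> \<beta> m q) \<in> A0"
      using less.hyps[OF separating_wall_reflection[OF w]] by blast
    then show ?thesis using Wa_comp[OF _ sW] by (metis comp_apply)
  qed
qed

section \<open>The lower Bruhat interval of \<open>\<theta>(\<lambda>)\<close>\<close>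

text \<open>Every coroot is conjugate to a simple one, and a simple reflection changes a single
  coefficient by a Cartan integer. Hence the simple coroots generate the coroot lattice.\<close>

lemma simple_coroot_coeff_Ints:
  assumes "x \<in> Q" "\<gamma> \<in> \<Delta>"
  shows "x \<bullet> \<varpi> \<gamma> \<in> \<int>"
proof -
  have orbit: "coroot (f \<alpha>) \<bullet> \<varpi> \<gamma> \<in> \<int>" if "f \<in> W" "\<alpha> \<in> \<Delta>" for f \<alpha>
    using that(1)
  proof (induction rule: W_induct)
    case id
    show ?case using coroot_fundamental_weight[OF that(2), of \<gamma>] by simp
  next
    case (step \<beta> f)
    have "coroot (\<sigma> \<beta> 0 (f \<alpha>)) = \<sigma> \<beta> 0 (coroot (f \<alpha>))"
      using W_coroot[OF W_simple[OF step(1)]] by simp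
    then have "coroot ((\<sigma> \<beta> 0 \<circ> f) \<alpha>) \<bullet> \<varpi> \<gamma>
        = coroot (f \<alpha>) \<bullet> \<varpi> \<gamma> - (\<beta> \<bullet> coroot (f \<alpha>)) * (if \<gamma> = \<beta> then 1 else 0)"
      using coroot_fundamental_weight[OF step(1), of \<gamma>]
      by (simp add: hyperplane_reflection_def inner_diff_left inner_commute[of _ \<beta>])
    moreover have "\<beta> \<bullet> coroot (f \<alpha>) \<in> \<int>"
      using crystallographic W_root[OF step(2)] simple_root step(1) that(2) by blast
    ultimately show ?case using step(3) by simp
  qed
  show ?thesis using assms(1)
  proof (induction rule: Q_induct)
    case (coroot \<alpha> c)
    then obtain f \<beta> where "f \<in> W" "\<beta> \<in> \<Delta>" "\<alpha> = f \<beta>" using root_conj_simple by blast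
    then show ?case using orbit[of f \<beta>] by simp
  qed (auto simp: inner_add_left)
qed

lemma eq_0_if_coroot_coeffs_0:
  assumes "\<And>\<gamma>. \<gamma> \<in> \<Delta> \<Longrightarrow> x \<bullet> \<varpi> \<gamma> = 0" shows "x = 0"
  using inner_coroot_expansion[of x x] assms by simp

section \<open>A dominant coweight and the existence of its alcove element\<close>

context
  fixes l :: 'a
  assumes l: "l \<in> dominant_coweights \<Delta>"
begin

lemma l_simple: "\<alpha> \<in> \<Delta> \<Longrightarrow> l \<bullet> \<alpha> \<in> \<nat>"
proof -
  assume a: "\<alpha> \<in> \<Delta>"
  obtain m :: "'a \<Rightarrow> nat" where m: "l = (\<Sum>\<beta>\<in>\<Delta>. real (m \<beta>) *\<^sub>R \<omega> \<beta>)"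
    using l unfolding dominant_coweights_def by blast
  have "l \<bullet> \<alpha> = (\<Sum>\<beta>\<in>\<Delta>. if \<beta> = \<alpha> then real (m \<beta>) else 0)"
    unfolding m inner_sum_left by (intro sum.cong) (auto simp: fundamental_coweight_inner[OF a])
  then show ?thesis using a finite_simple by simp
qed

lemma l_dominant: "dominant l"
  unfolding dominant_def using l_simple by (simp add: Nats_altdef2)

lemma l_Ints:
  assumes "\<beta> \<in> \<Phi>" shows "l \<bullet> \<beta> \<in> \<int>"
proof -
  have "\<beta> \<bullet> l \<in> \<int>" unfolding inner_simple_expansion[of \<beta> l]
    using root_coeff_Ints[OF assms] l_simple
    by (intro Ints_sum Ints_mult) (auto simp: inner_commute[of _ l] Nats_altdef2)
  then show ?thesis by (simp add: inner_commute)
qed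

lemma opposite_alcove_same_side:
  assumes "p \<in> A0" "r \<in> A0" "\<beta> \<in> \<Phi>" "k \<in> \<int>" "(l - p) \<bullet> \<beta> < k"
  shows "(l - r) \<bullet> \<beta> < k"
  using alcove_same_side[OF assms(1,2) minus_root[OF assms(3)], of "k - l \<bullet> \<beta>"]
    l_Ints[OF assms(3)] assms(4,5) by (simp add: inner_diff_left)

abbreviation \<theta> where "\<theta> \<equiv> theta_element \<Phi> \<Delta> l"

text \<open>The target alcove is \<open>l - A0\<close>, since the longest element negates the base
  alcove. Transitivity yields \<open>w\<close> taking \<open>l - p0\<close> into the base alcove; as
  \<open>l\<close> is integral on roots, the inverse of \<open>w\<close> carries the base alcove
  onto the target. Regularity gives uniqueness.\<close>

lemma theta: "\<theta> \<in> Wa" "\<theta> ` A0 = (\<lambda>r. l - r) ` A0"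
proof -
  have target: "(+) l ` alcove \<Phi> \<Delta> (longest_element \<Delta>) = (\<lambda>r. l - r) ` A0"
    unfolding alcove_def longest_element(2) by (simp add: image_image)
  let ?P = "\<lambda>w. w \<in> Wa \<and> alcove \<Phi> \<Delta> w = (+) l ` alcove \<Phi> \<Delta> (longest_element \<Delta>)"
  have "(l - p0) \<bullet> \<beta> \<notin> \<int>" if b: "\<beta> \<in> \<Phi>" for \<beta>
  proof
    assume "(l - p0) \<bullet> \<beta> \<in> \<int>"
    then have "l \<bullet> \<beta> - (l - p0) \<bullet> \<beta> \<in> \<int>" using l_Ints[OF b] by (rule Ints_diff[rotated])
    then have "p0 \<bullet> \<beta> \<in> \<int>" by (simp add: inner_diff_left)
    then show False using Wa_base_not_Ints[OF Wa_id b] by simp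
  qed
  then obtain w where w: "w \<in> Wa" "w (l - p0) \<in> A0" using alcove_transitive by blast
  let ?g = "inv_into UNIV w"
  have g: "?g \<in> Wa" using Wa_inverse(2)[OF w(1)] .
  have "?g ` A0 = (\<lambda>r. l - r) ` A0"
  proof
    show "?g ` A0 \<subseteq> (\<lambda>r. l - r) ` A0"
    proof
      fix y assume "y \<in> ?g ` A0"
      then obtain r where r: "r \<in> A0" "y = ?g r" by blast
      \<comment> \<open>The map \<open>?g\<close> sends \<open>r\<close> and
        \<open>w (l - p0)\<close>, two points of the base alcove, to \<open>y\<close> and
        \<open>l - p0\<close>, so no hyperplane separates the latter.\<close>
      have side: "y \<bullet> \<beta> < k" if b: "\<beta> \<in> \<Phi>" "k \<in> \<int>" "(l - p0) \<bullet> \<beta> < k" for \<beta> k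
      proof -
        obtain \<gamma> j where j: "\<gamma> \<in> \<Phi>" "j \<in> \<int>" "\<And>v. ?g v \<bullet> \<beta> - k = v \<bullet> \<gamma> - j"
          using Wa_pull_back[OF g b(1,2)] by metis
        have "w (l - p0) \<bullet> \<gamma> < j" using j(3)[of "w (l - p0)"] b(3) Wa_inverse(4)[OF w(1)] by simp
        then have "r \<bullet> \<gamma> < j" using alcove_same_side[OF w(2) r(1) j(1,2)] by blast
        then show ?thesis using j(3)[of r] r(2) by simp
      qed
      have "- 1 < (l - y) \<bullet> \<beta> \<and> (l - y) \<bullet> \<beta> < 0" if b: "\<beta> \<in> Pos" for \<beta>
      proof -
        have br: "\<beta> \<in> \<Phi>" using positive_root[OF b] .
        have "y \<bullet> \<beta> < l \<bullet> \<beta> + 1"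
          using side[OF br, of "l \<bullet> \<beta> + 1"] l_Ints[OF br] alcove_pos[OF p0 b] by (simp add: inner_diff_left)
        moreover have "y \<bullet> (- \<beta>) < - (l \<bullet> \<beta>)"
          using side[OF minus_root[OF br], of "- (l \<bullet> \<beta>)"] l_Ints[OF br] alcove_pos[OF p0 b]
          by (simp add: inner_diff_left)
        ultimately show ?thesis by (simp add: inner_diff_left)
      qed
      then have "l - y \<in> A0" unfolding fundamental_alcove_def by blast
      then show "y \<in> (\<lambda>r. l - r) ` A0" by (intro image_eqI[of _ _ "l - y"]) auto
    qed
    show "(\<lambda>r. l - r) ` A0 \<subseteq> ?g ` A0"
    proof
      fix y assume "y \<in> (\<lambda>r. l - r) ` A0"
      then obtain r where r: "r \<in> A0" "y = l - r" by blast
      have side: "w y \<bullet> \<beta> < k" if b: "\<beta> \<in> \<Phi>" "k \<in> \<int>" "w (l - p0) \<bullet> \<beta> < k" for \<beta> k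
      proof -
        obtain \<gamma> j where j: "\<gamma> \<in> \<Phi>" "j \<in> \<int>" "\<And>v. w v \<bullet> \<beta> - k = v \<bullet> \<gamma> - j"
          using Wa_pull_back[OF w(1) b(1,2)] by metis
        have "(l - p0) \<bullet> \<gamma> < j" using j(3)[of "l - p0"] b(3) by simp
        then have "y \<bullet> \<gamma> < j" using opposite_alcove_same_side[OF p0 r(1) j(1,2)] r(2) by simp
        then show ?thesis using j(3)[of y] by simp
      qed
      have "- 1 < w y \<bullet> \<beta> \<and> w y \<bullet> \<beta> < 0" if b: "\<beta> \<in> Pos" for \<beta>
        using side[OF positive_root[OF b], of 0] side[OF minus_root[OF positive_root[OF b]], of 1]
          alcove_pos[OF w(2) b] by simp
      then have "w y \<in> A0" unfolding fundamental_alcove_def by blast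
      then show "y \<in> ?g ` A0" using Wa_inverse(4)[OF w(1)] by (metis imageI)
    qed
  qed
  then have "?P ?g" using g target unfolding alcove_def by blast
  moreover have "w = u" if "?P w" "?P u" for w u
  proof -
    have w: "w \<in> Wa" and u: "u \<in> Wa" and eq: "u ` A0 = w ` A0" using that unfolding alcove_def by auto
    have "u p0 \<in> w ` A0" using eq p0 by blast
    then have "(inv_into UNIV w \<circ> u) p0 \<in> A0" using Wa_inverse(4)[OF w] by auto
    then have "inv_into UNIV w \<circ> u = id" using Wa_regular Wa_comp Wa_inverse(2) w u by blast
    then have "w (inv_into UNIV w (u x)) = w x" for x by (metis comp_apply id_apply)
    then show "w = u" using Wa_inverse(3)[OF w] by (auto simp: fun_eq_iff)
  qed
  ultimately have "\<exists>!w. ?P w" by blast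
  from theI'[OF this] have "?P \<theta>" unfolding theta_element_def .
  then show "\<theta> \<in> Wa" "\<theta> ` A0 = (\<lambda>r. l - r) ` A0" unfolding target by (auto simp: alcove_def)
qed

lemma theta_unique:
  assumes "u \<in> Wa" "l - u p0 \<in> A0" shows "u = \<theta>"
proof -
  have "u p0 \<in> \<theta> ` A0" unfolding theta(2) using assms(2) by (intro image_eqI[of _ _ "l - u p0"]) auto
  then have "(inv_into UNIV \<theta> \<circ> u) p0 \<in> A0" using Wa_inverse(4)[OF theta(1)] by auto
  then have "inv_into UNIV \<theta> \<circ> u = id"
    using Wa_regular Wa_comp[OF Wa_inverse(2)[OF theta(1)] assms(1)] by blast
  then have "\<theta> (inv_into UNIV \<theta> (u x)) = \<theta> x" for x by (metis comp_apply id_apply)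
  then show ?thesis using Wa_inverse(3)[OF theta(1)] by (auto simp: fun_eq_iff)
qed

section \<open>The special vertex and its images\<close>

text \<open>The vertex of the fundamental alcove that \<open>\<theta>\<close> carries to \<open>l\<close>; it is a special point, so
  \<open>u \<mapsto> u \<nu>\<close> identifies the cosets of its stabiliser with \<open>l + Q\<close>.\<close>

definition \<nu> where "\<nu> = inv_into UNIV \<theta> l"

lemma theta_vertex: "\<theta> \<nu> = l"
  unfolding \<nu>_def using Wa_inverse(3)[OF theta(1)] .

text \<open>An element is determined by its image of the vertex and a linear part \<open>f\<close>.
  That image is \<open>x + f l\<close> with \<open>x\<close> in the coroot lattice, and
  \<open>l - f l\<close> is in the lattice as well.\<close>

lemma Wa_decompose:
  assumes "u \<in> Wa"
  obtains f where "f \<in> W" "u \<nu> - l \<in> Q" "\<And>z. u z = u \<nu> + f (\<theta> z - l)"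
proof -
  have "u \<circ> inv_into UNIV \<theta> \<in> Wa" using Wa_comp[OF assms Wa_inverse(2)[OF theta(1)]] .
  then obtain x f where xf: "x \<in> Q" "f \<in> W" "u \<circ> inv_into UNIV \<theta> = (\<lambda>v. x + f v)"
    unfolding Wa_iff by blast
  have u: "u z = x + f (\<theta> z)" for z
    using fun_cong[OF xf(3), of "\<theta> z"] Wa_inverse(4)[OF theta(1)] by simp
  have v: "u \<nu> = x + f l" using u[of \<nu>] theta_vertex by simp
  have "u z = u \<nu> + f (\<theta> z - l)" for z
    using u[of z] v W_linear[OF xf(2)] by (simp add: linear_diff)
  moreover have "u \<nu> - l \<in> Q"
    using Q_diff[OF xf(1) W_coweight_diff[OF xf(2) l_Ints]] v by (simp add: algebra_simps)
  ultimately show ?thesis using that xf(2) by blast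
qed

lemma vertex_Ints:
  assumes "u \<in> Wa" "\<beta> \<in> \<Phi>" shows "u \<nu> \<bullet> \<beta> \<in> \<int>"
proof -
  have "u \<nu> - l \<in> Q" using Wa_decompose[OF assms(1)] by metis
  then have "(u \<nu> - l) \<bullet> \<beta> + l \<bullet> \<beta> \<in> \<int>" using Q_inner[OF _ assms(2)] l_Ints[OF assms(2)] by simp
  then show ?thesis by (simp add: inner_diff_left)
qed

text \<open>The two image points differ by a linear image of a point of the base alcove, on which
  roots have absolute value below 1.\<close>

lemma vertex_near:
  assumes "u \<in> Wa" "\<beta> \<in> \<Phi>" shows "\<bar>u p0 \<bullet> \<beta> - u \<nu> \<bullet> \<beta>\<bar> < 1"
proof -
  obtain f where f: "f \<in> W" "\<And>z. u z = u \<nu> + f (\<theta> z - l)" using Wa_decompose[OF assms(1)] by metis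
  obtain r where r: "r \<in> A0" "\<theta> p0 = l - r" using theta(2) p0 by blast
  have "u p0 \<bullet> \<beta> - u \<nu> \<bullet> \<beta> = f (- r) \<bullet> \<beta>" using f(2)[of p0] r(2) by (simp add: inner_add_left)
  also have "\<dots> = - (r \<bullet> inv_into UNIV f \<beta>)" using W_inner_left[OF f(1)] by simp
  finally show ?thesis
    using alcove_root(1)[OF r(1) W_root[OF W_inverse(2)[OF f(1)] assms(2)]] by simp
qed

text \<open>The vertex value is an integer below k + 1, hence at most k. Passing from the alcove to
  its vertex thus costs only strictness.\<close>

lemma vertex_le:
  assumes "u \<in> Wa" "\<beta> \<in> \<Phi>" "k \<in> \<int>" "u p0 \<bullet> \<beta> < k" shows "u \<nu> \<bullet> \<beta> \<le> k"
  using vertex_near[OF assms(1,2)] assms(4)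
    Ints_less_imp_le_diff[OF vertex_Ints[OF assms(1,2)], of "k + 1"] assms(3) by force

lemma vertex_less:
  assumes "u \<in> Wa" "\<beta> \<in> \<Phi>" "k \<in> \<int>" "u \<nu> \<bullet> \<beta> < k" shows "u p0 \<bullet> \<beta> < k"
  using vertex_near[OF assms(1,2)] Ints_less_imp_le_diff[OF vertex_Ints[OF assms(1,2)] assms(3,4)] by force

section \<open>Bruhat steps by reflections in hyperplanes\<close>

abbreviation le where "le \<equiv> affine_bruhat_le \<Phi> \<Delta>"

lemma le_refl: "le u u"
  unfolding affine_bruhat_le_def bruhat_le_def by simp

lemma le_trans: "\<lbrakk>le u v; le v w\<rbrakk> \<Longrightarrow> le u w"
  unfolding affine_bruhat_le_def bruhat_le_def by (rule rtranclp_trans)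

text \<open>Pulling the hyperplane back along \<open>u\<close> turns the left factor into a right
  one, as the definition of the Bruhat order asks; the length grows because \<open>u p0\<close> is
  on the same side as \<open>p0\<close>.\<close>

lemma bruhat_step:
  assumes "u \<in> Wa" "\<alpha> \<in> \<Phi>" "k \<in> \<int>" "p0 \<bullet> \<alpha> < k" "u p0 \<bullet> \<alpha> < k"
  shows "\<sigma> \<alpha> k \<circ> u \<in> Wa" "word_length Sa u < word_length Sa (\<sigma> \<alpha> k \<circ> u)" "le u (\<sigma> \<alpha> k \<circ> u)"
proof -
  show W: "\<sigma> \<alpha> k \<circ> u \<in> Wa" using Wa_comp[OF Wa_reflection[OF assms(2,3)] assms(1)] .
  show len: "word_length Sa u < word_length Sa (\<sigma> \<alpha> k \<circ> u)"
    using length_less_reflected[OF affine_wall_reflections] assms W unfolding Wa_eq_words by blast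
  obtain \<beta> m where b: "\<beta> \<in> \<Phi>" "m \<in> \<int>" "u \<circ> \<sigma> \<beta> m = \<sigma> \<alpha> k \<circ> u"
    using Wa_pull_back[OF assms(1-3)] by metis
  have "\<exists>t\<in>coxeter_reflections Wa Sa. \<sigma> \<alpha> k \<circ> u = u \<circ> t \<and> word_length Sa u < word_length Sa (\<sigma> \<alpha> k \<circ> u)"
    using reflection_in_coxeter_reflections[OF b(1,2)] b(3) len by metis
  then show "le u (\<sigma> \<alpha> k \<circ> u)"
    unfolding affine_bruhat_le_def bruhat_le_def using assms(1) by (intro r_into_rtranclp conjI)
qed

section \<open>The convex hull of the orbit, and Bruhat steps within it\<close>

abbreviation C where "C \<equiv> convex hull ((\<lambda>w. w l) ` W)"

lemma C_invariant:
  assumes "f \<in> W" "x \<in> C" shows "f x \<in> C"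
proof -
  have "f ` (\<lambda>w. w l) ` W \<subseteq> (\<lambda>w. w l) ` W"
  proof
    fix y assume "y \<in> f ` (\<lambda>w. w l) ` W"
    then obtain w where "w \<in> W" "y = (f \<circ> w) l" by auto
    then show "y \<in> (\<lambda>w. w l) ` W" using W_comp[OF assms(1)] by blast
  qed
  then have "convex hull (f ` (\<lambda>w. w l) ` W) \<subseteq> C" by (rule hull_mono)
  then show ?thesis
    using assms(2) convex_hull_linear_image[OF W_linear[OF assms(1)], of "(\<lambda>w. w l) ` W"] by blast
qed

lemma l_in_C: "l \<in> C"
  using W_id hull_subset[of "(\<lambda>w. w l) ` W" convex] by force

text \<open>The inequality cuts out a half-space containing the orbit of \<open>l\<close>, and
  therefore its hull.\<close>

lemma C_coeff:
  assumes "x \<in> C" "\<gamma> \<in> \<Delta>" shows "0 \<le> (l - x) \<bullet> \<varpi> \<gamma>"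
proof -
  have "(\<lambda>w. w l) ` W \<subseteq> {x. \<varpi> \<gamma> \<bullet> x \<le> \<varpi> \<gamma> \<bullet> l}"
    using dominant_diff_orbit[OF l_dominant _ assms(2)] by (auto simp: inner_diff_left inner_commute[of "\<varpi> \<gamma>"])
  then have "C \<subseteq> {x. \<varpi> \<gamma> \<bullet> x \<le> \<varpi> \<gamma> \<bullet> l}" by (rule hull_minimal) (rule convex_halfspace_le)
  then show ?thesis using assms(1) by (auto simp: inner_diff_left inner_commute[of "\<varpi> \<gamma>"])
qed

text \<open>As the length grows from \<open>u\<close> to \<open>u \<circ> t\<close>, the hyperplane
  does not separate \<open>u p0\<close> from \<open>p0\<close>. So the lower vertex lies on the
  segment from the upper vertex \<open>y\<close> to its linear reflection, and the hull contains
  both ends.\<close>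

lemma lower_step_in_C:
  assumes u: "u \<in> Wa" and t: "t \<in> coxeter_reflections Wa Sa"
    and len: "word_length Sa u < word_length Sa (u \<circ> t)" and C: "(u \<circ> t) \<nu> \<in> C"
  shows "u \<nu> \<in> C"
proof -
  obtain \<alpha> k where a: "\<alpha> \<in> \<Phi>" "k \<in> \<int>" "p0 \<bullet> \<alpha> < k" "u \<circ> t = \<sigma> \<alpha> k \<circ> u"
    using coxeter_reflection_hyperplane[OF t u] .
  have "\<not> k < u p0 \<bullet> \<alpha>"
    using exchange_length[OF affine_wall_reflections _ a(1-3), of u] u len a(4)
    unfolding Wa_eq_words by fastforce
  then have "u p0 \<bullet> \<alpha> < k"
    using Wa_base_not_Ints[OF u a(1)] a(2) by (metis linorder_neqE_linordered_idom)
  then have uk: "u \<nu> \<bullet> \<alpha> \<le> k" using vertex_le[OF u a(1,2)] by blast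
  have "\<bar>p0 \<bullet> \<alpha>\<bar> < 1" using alcove_root(1)[OF p0 a(1)] .
  \<comment> \<open>The value of \<alpha> at \<open>p0\<close> exceeds -1, so an integer above it is
    nonnegative: \<open>p0\<close> and the origin lie weakly on the same side.\<close>
  then have k0: "0 \<le> k" using Ints_strictly_between[OF a(2), of "- 1"] a(3) by force
  define y where "y = \<sigma> \<alpha> k (u \<nu>)"
  have yC: "y \<in> C" using C a(4) unfolding y_def by (metis comp_apply)
  have ya: "y \<bullet> \<alpha> = 2 * k - u \<nu> \<bullet> \<alpha>"
    unfolding y_def by (rule hyperplane_reflection_inner_self[OF root_nonzero[OF a(1)]])
  have uy: "u \<nu> = y - (y \<bullet> \<alpha> - k) *\<^sub>R coroot \<alpha>"
    using hyperplane_reflection_involution[OF root_nonzero[OF a(1)], of k "u \<nu>"]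
    unfolding y_def by (simp add: hyperplane_reflection_def)
  show ?thesis
  proof (cases "y \<bullet> \<alpha> = 0")
    case True
    then have "y \<bullet> \<alpha> - k = 0" using ya uk k0 by linarith
    then have "u \<nu> = y" using uy by (metis diff_zero scaleR_zero_left)
    then show ?thesis using yC by simp
  next
    case False
    then have pos: "0 < y \<bullet> \<alpha>" using ya uk k0 by linarith
    \<comment> \<open>The parameter of \<open>u \<nu>\<close> on the segment from \<open>y\<close>
      to \<open>\<sigma> \<alpha> 0 y\<close>; it is at most 1 because \<open>k\<close> is
      nonnegative.\<close>
    define c where "c = (y \<bullet> \<alpha> - k) / (y \<bullet> \<alpha>)"
    have c: "0 \<le> c" "c \<le> 1" "c * (y \<bullet> \<alpha>) = y \<bullet> \<alpha> - k"
      unfolding c_def using pos ya uk k0 by (auto simp: field_simps)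
    have "u \<nu> = (1 - c) *\<^sub>R y + c *\<^sub>R \<sigma> \<alpha> 0 y"
      unfolding uy c(3)[symmetric] by (simp add: hyperplane_reflection_def algebra_simps)
    then show ?thesis
      using convexD[OF convex_convex_hull yC C_invariant[OF W_reflection[OF a(1)] yC], of "1 - c" c] c by simp
  qed
qed

lemma le_theta_imp_in_C:
  assumes "le u \<theta>" shows "u \<nu> \<in> C"
  using assms unfolding affine_bruhat_le_def bruhat_le_def
proof (induction rule: converse_rtranclp_induct)
  case base
  show ?case using theta_vertex l_in_C by simp
next
  case (step u w)
  then show ?case using lower_step_in_C by blast
qed

text \<open>Reflecting in a simple root that is negative at the vertex goes up in the Bruhat order
  and stays in the hull. It lowers \<open>N\<close>, the natural number summing the simple coroot
  coefficients of \<open>l - u \<nu>\<close>, so the process ends.\<close>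

lemma raise_to_dominant:
  assumes "u \<in> Wa" "u \<nu> \<in> C"
  shows "\<exists>w\<in>Wa. le u w \<and> w \<nu> \<in> C \<and> dominant (w \<nu>)"
proof -
  define N where "N x = (\<Sum>\<gamma>\<in>\<Delta>. (l - x) \<bullet> \<varpi> \<gamma>)" for x
  have N: "\<exists>n. N (u \<nu>) = real n" if u: "u \<in> Wa" "u \<nu> \<in> C" for u
  proof -
    have "l - u \<nu> \<in> Q" using Wa_decompose[OF u(1)] Q_minus by (metis minus_diff_eq)
    then have "N (u \<nu>) \<in> \<int>" unfolding N_def using simple_coroot_coeff_Ints by (intro Ints_sum) blast
    moreover have "0 \<le> N (u \<nu>)" unfolding N_def using C_coeff[OF u(2)] by (intro sum_nonneg) blast
    ultimately have "N (u \<nu>) \<in> \<nat>" unfolding Nats_altdef2 by blast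
    then show ?thesis by (auto elim: Nats_cases)
  qed
  then obtain n where "N (u \<nu>) = real n" using assms by blast
  then show ?thesis using assms
  proof (induction n arbitrary: u rule: less_induct)
    case (less n)
    show ?case
    proof (cases "dominant (u \<nu>)")
      case True
      then show ?thesis using less.prems le_refl by blast
    next
      case False
      then obtain \<alpha> where a: "\<alpha> \<in> \<Delta>" "u \<nu> \<bullet> \<alpha> < 0" unfolding dominant_def by force
      let ?w = "\<sigma> \<alpha> 0 \<circ> u"
      have "p0 \<bullet> \<alpha> < 0" using alcove_pos[OF p0 simple_positive[OF a(1)]] by blast
      moreover have "u p0 \<bullet> \<alpha> < 0" using vertex_less[OF less.prems(2) simple_root[OF a(1)] Ints_0 a(2)] .
      ultimately have w: "?w \<in> Wa" "le u ?w"
        using bruhat_step[OF less.prems(2) simple_root[OF a(1)] Ints_0] by blast+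
      have wC: "?w \<nu> \<in> C" using C_invariant[OF W_simple[OF a(1)] less.prems(3)] by simp
      obtain m where m: "N (?w \<nu>) = real m" using N[OF w(1) wC] by blast
      have "(l - ?w \<nu>) \<bullet> \<varpi> \<gamma> = (l - u \<nu>) \<bullet> \<varpi> \<gamma> + (if \<gamma> = \<alpha> then u \<nu> \<bullet> \<alpha> else 0)" for \<gamma>
        using coroot_fundamental_weight[OF a(1), of \<gamma>] by (auto simp: hyperplane_reflection_def inner_diff_left)
      then have "N (?w \<nu>) = N (u \<nu>) + u \<nu> \<bullet> \<alpha>"
        unfolding N_def using a(1) finite_simple by (simp add: sum.distrib)
      then have "m < n" using m less.prems(1) a(2) by simp
      from less.IH[OF this m w(1) wC] show ?thesis using le_trans[OF w(2)] by blast
    qed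
  qed
qed

text \<open>Induction on the coefficient sum of \<open>x - u \<nu>\<close>. The positive norm of
  this difference yields a simple \<alpha> at which it has both a positive coefficient and a
  positive product. Then \<open>x - coroot \<alpha>\<close> still satisfies the hypotheses and is
  reached first; dominance of \<open>u \<nu>\<close> makes the last step go up.\<close>

lemma raise_from_dominant:
  assumes "u \<in> Wa" "dominant (u \<nu>)"
  shows "\<lbrakk>x - u \<nu> \<in> Q; \<And>\<gamma>. \<gamma> \<in> \<Delta> \<Longrightarrow> 0 \<le> (x - u \<nu>) \<bullet> \<varpi> \<gamma>;
      (\<Sum>\<gamma>\<in>\<Delta>. (x - u \<nu>) \<bullet> \<varpi> \<gamma>) = real n\<rbrakk> \<Longrightarrow> \<exists>w\<in>Wa. le u w \<and> w \<nu> = x"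
proof (induction n arbitrary: x)
  case 0
  then have "(x - u \<nu>) \<bullet> \<varpi> \<gamma> = 0" if "\<gamma> \<in> \<Delta>" for \<gamma>
    using that sum_nonneg_eq_0_iff[OF finite_simple, of "\<lambda>\<gamma>. (x - u \<nu>) \<bullet> \<varpi> \<gamma>"] by simp
  then have "x = u \<nu>" using eq_0_if_coroot_coeffs_0[of "x - u \<nu>"] by simp
  then show ?case using assms(1) le_refl by blast
next
  case (Suc n)
  let ?d = "x - u \<nu>"
  have "?d \<noteq> 0" using Suc.prems(3) by (metis (no_types, lifting) inner_zero_left of_nat_eq_0_iff old.nat.distinct(2) sum.neutral)
  then have "0 < ?d \<bullet> ?d" by simp
  then obtain \<alpha> where a: "\<alpha> \<in> \<Delta>" "0 < (?d \<bullet> \<varpi> \<alpha>) * (coroot \<alpha> \<bullet> ?d)"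
    using inner_coroot_expansion[of ?d ?d] sum_nonpos[of \<Delta> "\<lambda>\<alpha>. (?d \<bullet> \<varpi> \<alpha>) * (coroot \<alpha> \<bullet> ?d)"] by force
  then have fa: "0 < ?d \<bullet> \<varpi> \<alpha>" and "0 < coroot \<alpha> \<bullet> ?d"
    using Suc.prems(2)[OF a(1)] by (auto simp: zero_less_mult_iff)
  then have "0 < ?d \<bullet> \<alpha>"
    using inner_ge_zero[of \<alpha>] by (auto simp: coroot_def inner_commute zero_less_divide_iff)
  then have xa: "0 < x \<bullet> \<alpha>" using assms(2) a(1) unfolding dominant_def by (force simp: inner_diff_left)
  have ar: "\<alpha> \<in> \<Phi>" using simple_root[OF a(1)] .
  have "?d \<bullet> \<alpha> + u \<nu> \<bullet> \<alpha> \<in> \<int>" using Q_inner[OF Suc.prems(1) ar] vertex_Ints[OF assms(1) ar] by simp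
  then have xi: "x \<bullet> \<alpha> \<in> \<int>" by (simp add: inner_diff_left)
  define z where "z = x - coroot \<alpha>"
  have coeff: "(z - u \<nu>) \<bullet> \<varpi> \<gamma> = ?d \<bullet> \<varpi> \<gamma> - (if \<gamma> = \<alpha> then 1 else 0)" for \<gamma>
    unfolding z_def using coroot_fundamental_weight[OF a(1), of \<gamma>] by (simp add: inner_diff_left)
  have zQ: "z - u \<nu> \<in> Q"
    using Q_diff[OF Suc.prems(1) Q_scale_coroot[OF ar, of 1]] unfolding z_def by (simp add: algebra_simps)
  moreover have "0 \<le> (z - u \<nu>) \<bullet> \<varpi> \<gamma>" if g: "\<gamma> \<in> \<Delta>" for \<gamma>
  proof (cases "\<gamma> = \<alpha>")
    case True
    have "0 \<le> ?d \<bullet> \<varpi> \<alpha> - 1"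
      using Ints_less_imp_le_diff[OF Ints_0 simple_coroot_coeff_Ints[OF Suc.prems(1) a(1)] fa] .
    then show ?thesis using coeff[of \<gamma>] True by simp
  next
    case False
    then show ?thesis using coeff[of \<gamma>] Suc.prems(2)[OF g] by simp
  qed
  moreover have "(\<Sum>\<gamma>\<in>\<Delta>. (z - u \<nu>) \<bullet> \<varpi> \<gamma>) = real n"
    unfolding coeff sum_subtractf using Suc.prems(3) a(1) finite_simple by simp
  ultimately obtain w where w: "w \<in> Wa" "le u w" "w \<nu> = z" using Suc.IH by blast
  \<comment> \<open>The level halfway between \<open>z\<close> and \<open>x\<close>. It is
    nonnegative since \<open>x \<bullet> \<alpha>\<close> is a positive integer, so
    \<open>p0\<close> and \<open>w p0\<close> both lie below it.\<close>
  let ?k = "x \<bullet> \<alpha> - 1"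
  have k: "?k \<in> \<int>" "0 \<le> ?k" using xi Ints_less_imp_le_diff[OF Ints_0 xi xa] by simp_all
  have za: "z \<bullet> \<alpha> = x \<bullet> \<alpha> - 2"
    unfolding z_def using inner_coroot_self[OF root_nonzero[OF ar]] by (simp add: inner_diff_left inner_commute[of "coroot \<alpha>"])
  have "p0 \<bullet> \<alpha> < ?k" using alcove_pos[OF p0 simple_positive[OF a(1)]] k(2) by simp
  moreover have "w p0 \<bullet> \<alpha> < ?k" using vertex_less[OF w(1) ar k(1)] w(3) za by simp
  ultimately have s: "\<sigma> \<alpha> ?k \<circ> w \<in> Wa" "le w (\<sigma> \<alpha> ?k \<circ> w)" using bruhat_step[OF w(1) ar k(1)] by blast+
  have "(\<sigma> \<alpha> ?k \<circ> w) \<nu> = x" using w(3) za unfolding hyperplane_reflection_def by (simp add: z_def)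
  then show ?case using s le_trans[OF w(2)] by blast
qed

text \<open>Among the elements above \<open>u\<close> that carry the vertex to \<open>l\<close>, a
  longest one cannot be raised by a reflection in a hyperplane through \<open>l\<close>. Its alcove
  is therefore beyond all of these, which characterises \<theta>.\<close>

lemma le_theta_if_vertex:
  assumes "u \<in> Wa" "u \<nu> = l" shows "le u \<theta>"
proof -
  define F where "F = {w \<in> Wa. w \<nu> = l \<and> le u w}"
  \<comment> \<open>With the image of the vertex fixed, the linear part in the finite group
    determines the element, so \<open>F\<close> is finite.\<close>
  have "F \<subseteq> (\<lambda>f z. l + f (\<theta> z - l)) ` W"
  proof
    fix w assume w: "w \<in> F"
    then obtain f where "f \<in> W" "\<And>z. w z = w \<nu> + f (\<theta> z - l)" using Wa_decompose unfolding F_def by blast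
    moreover have "w \<nu> = l" using w unfolding F_def by blast
    ultimately show "w \<in> (\<lambda>f z. l + f (\<theta> z - l)) ` W" by (intro image_eqI[of _ _ f]) auto
  qed
  then have "finite F" using W_finite finite_surj by blast
  moreover have "u \<in> F" unfolding F_def using assms le_refl by blast
  ultimately obtain w where m: "is_arg_max (word_length Sa) (\<lambda>w. w \<in> F) w" using finite_is_arg_max by blast
  then have w: "w \<in> Wa" "w \<nu> = l" "le u w" unfolding is_arg_max_def F_def by blast+
  have "- 1 < (l - w p0) \<bullet> \<alpha> \<and> (l - w p0) \<bullet> \<alpha> < 0" if a: "\<alpha> \<in> Pos" for \<alpha>
  proof -
    have ar: "\<alpha> \<in> \<Phi>" using positive_root[OF a] .
    let ?k = "l \<bullet> \<alpha>"
    have k: "?k \<in> \<int>" using l_Ints[OF ar] .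
    have "\<not> w p0 \<bullet> \<alpha> < ?k"
    proof
      assume lt: "w p0 \<bullet> \<alpha> < ?k"
      have "p0 \<bullet> \<alpha> < ?k" using alcove_pos[OF p0 a] dominant_positive[OF l_dominant a] by linarith
      note st = bruhat_step[OF w(1) ar k this lt]
      have "(\<sigma> \<alpha> ?k \<circ> w) \<nu> = l" using w(2) by (simp add: hyperplane_reflection_def)
      then have "\<sigma> \<alpha> ?k \<circ> w \<in> F" unfolding F_def using st le_trans[OF w(3)] by blast
      then show False using m st(2) unfolding is_arg_max_def by blast
    qed
    moreover have "w p0 \<bullet> \<alpha> \<noteq> ?k" using Wa_base_not_Ints[OF w(1) ar] k by metis
    \<comment> \<open>The hyperplane through \<open>l\<close> gives the upper bound, closeness to
      the vertex the lower one.\<close>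
    ultimately show ?thesis using vertex_near[OF w(1) ar] w(2) by (simp add: inner_diff_left)
  qed
  then have "l - w p0 \<in> A0" unfolding fundamental_alcove_def by blast
  then show ?thesis using theta_unique[OF w(1)] w(3) by blast
qed

section \<open>The lower interval and its cardinality\<close>

lemma le_theta_iff:
  assumes "u \<in> Wa" shows "le u \<theta> \<longleftrightarrow> u \<nu> \<in> C"
proof
  assume "u \<nu> \<in> C"
  then obtain w where w: "w \<in> Wa" "le u w" "w \<nu> \<in> C" "dominant (w \<nu>)"
    using raise_to_dominant[OF assms] by blast
  have Q: "l - w \<nu> \<in> Q" using Wa_decompose[OF w(1)] Q_minus by (metis minus_diff_eq)
  have nn: "0 \<le> (l - w \<nu>) \<bullet> \<varpi> \<gamma>" if "\<gamma> \<in> \<Delta>" for \<gamma> using C_coeff[OF w(3) that] .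
  have "(\<Sum>\<gamma>\<in>\<Delta>. (l - w \<nu>) \<bullet> \<varpi> \<gamma>) \<in> \<nat>"
    unfolding Nats_altdef2 using nn simple_coroot_coeff_Ints[OF Q]
    by (intro CollectI conjI Ints_sum sum_nonneg) auto
  then obtain n where "(\<Sum>\<gamma>\<in>\<Delta>. (l - w \<nu>) \<bullet> \<varpi> \<gamma>) = real n" by (auto elim: Nats_cases)
  from raise_from_dominant[OF w(1,4) Q nn this] obtain v where "v \<in> Wa" "le w v" "v \<nu> = l" by blast
  then show "le u \<theta>" using le_theta_if_vertex le_trans w(2) by blast
qed (rule le_theta_imp_in_C)

text \<open>The map \<open>?\<phi>\<close> parametrises elements by their linear part relative to
  \<theta> and their image of the vertex. By \<open>le_theta_iff\<close>, the order condition
  concerns that image alone.\<close>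

lemma card_lower_interval:
  "card {w \<in> Wa. le w \<theta>} = card W * card (C \<inter> (+) l ` Q)"
proof -
  let ?\<phi> = "\<lambda>(f, \<mu>) z. \<mu> + f (\<theta> z - l)"
  let ?B = "C \<inter> (+) l ` Q"
  have vertex: "?\<phi> (f, \<mu>) \<nu> = \<mu>" if "f \<in> W" for f \<mu>
    using theta_vertex linear_0[OF W_linear[OF that]] by simp
  have "bij_betw ?\<phi> (W \<times> ?B) {w \<in> Wa. le w \<theta>}"
    unfolding bij_betw_def
  proof
    show "inj_on ?\<phi> (W \<times> ?B)"
    proof (rule inj_onI)
      fix x y assume x: "x \<in> W \<times> ?B" and y: "y \<in> W \<times> ?B" and eq: "?\<phi> x = ?\<phi> y"
      obtain f \<mu> g \<kappa> where xy: "x = (f, \<mu>)" "y = (g, \<kappa>)" by fastforce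
      have "f \<in> W" "g \<in> W" using x y unfolding xy by blast+
      then have "\<mu> = \<kappa>" using vertex[of f \<mu>] vertex[of g \<kappa>] fun_cong[OF eq, of \<nu>] unfolding xy by simp
      then have "f (\<theta> z - l) = g (\<theta> z - l)" for z using fun_cong[OF eq, of z] unfolding xy by simp
      \<comment> \<open>As \<theta> is surjective, \<open>\<theta> z - l\<close> runs through the
        whole space.\<close>
      from this[of "inv_into UNIV \<theta> (_ + l)"] have "f = g"
        using Wa_inverse(3)[OF theta(1)] by (auto simp: fun_eq_iff)
      then show "x = y" using \<open>\<mu> = \<kappa>\<close> xy by simp
    qed
    show "?\<phi> ` (W \<times> ?B) = {w \<in> Wa. le w \<theta>}"
    proof
      show "?\<phi> ` (W \<times> ?B) \<subseteq> {w \<in> Wa. le w \<theta>}"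
      proof
        fix w assume "w \<in> ?\<phi> ` (W \<times> ?B)"
        then obtain f \<mu> where f: "f \<in> W" "\<mu> \<in> ?B" "w = ?\<phi> (f, \<mu>)" by auto
        then have "\<mu> - l \<in> Q" by auto
        \<comment> \<open>The sum is \<open>\<mu> - f l\<close>, the translation part of
          \<open>w\<close> composed with the inverse of \<theta>.\<close>
        then have "(\<mu> - l) + (l - f l) \<in> Q" using Q_add W_coweight_diff[OF f(1) l_Ints] by blast
        then have "(\<lambda>v. (\<mu> - f l) + f v) \<in> Wa" unfolding Wa_iff using f(1) by auto
        from Wa_comp[OF this theta(1)] have "w \<in> Wa"
          using f W_linear[OF f(1)] by (simp add: linear_diff o_def algebra_simps)
        moreover have "w \<nu> \<in> C" using vertex[OF f(1), of \<mu>] f(2,3) by simp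
        ultimately show "w \<in> {w \<in> Wa. le w \<theta>}" using le_theta_iff by blast
      qed
      show "{w \<in> Wa. le w \<theta>} \<subseteq> ?\<phi> ` (W \<times> ?B)"
      proof
        fix w assume "w \<in> {w \<in> Wa. le w \<theta>}"
        then have w: "w \<in> Wa" "w \<nu> \<in> C" using le_theta_iff by blast+
        obtain f where f: "f \<in> W" "w \<nu> - l \<in> Q" "\<And>z. w z = w \<nu> + f (\<theta> z - l)"
          using Wa_decompose[OF w(1)] by blast
        have "w \<nu> \<in> (+) l ` Q" using f(2) by (intro image_eqI[of _ _ "w \<nu> - l"]) auto
        then have "(f, w \<nu>) \<in> W \<times> ?B" using f(1) w(2) by blast
        moreover have "w = ?\<phi> (f, w \<nu>)" by (rule ext) (simp only: prod.case f(3)[symmetric])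
        ultimately show "w \<in> ?\<phi> ` (W \<times> ?B)" by (rule image_eqI[rotated])
      qed
    qed
  qed
  from bij_betw_same_card[OF this] show ?thesis unfolding card_cartesian_product by (rule sym)
qed

end

end

theorem theoremA:
  fixes \<Phi> \<Delta> :: "'a::euclidean_space set" and l :: 'a
  assumes "irreducible_root_system_with_base \<Phi> \<Delta>"
    and "l \<in> dominant_coweights \<Delta>"
  shows "card {w \<in> affine_weyl_group \<Phi> \<Delta>. affine_bruhat_le \<Phi> \<Delta> w (theta_element \<Phi> \<Delta> l)}
       = card (finite_weyl_group \<Delta>)
         * card (convex hull ((\<lambda>w. w l) ` finite_weyl_group \<Delta>) \<inter> (+) l ` coroot_lattice \<Phi>)"
proof -
  interpret irreducible_root_system_with_base \<Phi> \<Delta> by fact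
  show ?thesis using assms(2) by (rule card_lower_interval)
qed

end
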